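(* Let $n\ge1$ be an integer. The number of solutions of length $n$ (for all possible values of $\mathfrak a\ge1$ and $\mathfrak b\ge0$), counted up to isomorphism and application of $L$, equals $$\left\lfloor\frac n2\right\rfloor+1+\sum_{\substack{d\mid n\\ 2<d\le n}}\mathcal H(n,d),$$ where $$\mathcal H(n,d)=\left(2^{\mathcal O(n/d)-1}-1\right)\left(\frac{\varphi(d)}2-\sigma(d-1)+1\right).$$ Here counting up to isomorphism and application of $L$ means counting the words $w$ of length $n$ that begin with the letter $0$, do not contain the factor $11$, and are solutions with parameters $(\mathfrak a,\mathfrak b)$ for some integers $\mathfrak a\ge1$, $\mathfrak b\ge0$.
   Context: $\varphi$ is Euler's totient function, $\sigma(k)$ is the number of distinct positive divisors of $k$ (with $1$ and $k$ included), and $\mathcal O(\ell)$ is the number of orbits of the map $x\mapsto 2x\bmod\ell$ on $\{0,\dots,\ell-1\}$, where $i,j$ are in the same orbit if there are $k_1,k_2\ge0$ with $2^{k_1}i\equiv2^{k_2}j\pmod\ell$. Words are over $\{0,1\}$. For integers $\mathfrak a\ge1$, $\mathfrak b\ge0$ let $S_1=0$, $S_2=010^{\mathfrak a-1}$, $S_3=010^{\mathfrak a}$, $S_4=10^{\mathfrak a}$, $S_5=10^{\mathfrak a+1}(10^{\mathfrak a})^{\mathfrak b}$, $S_6=10^{\mathfrak a+1}(10^{\mathfrak a})^{\mathfrak b+1}$. Let $\mathcal L(\mathfrak a,\mathfrak b)$ be the set of all finite factors of infinite concatenations of the words $S_5$ and $S_6$. Let $\Pi(\mathfrak a,\mathfrak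 b)$ be the set of nonempty words in $\mathcal L(\mathfrak a,\mathfrak b)$ that are products $X_1^2\cdots X_n^2$ with all $X_i\in\{S_1,\dots,S_6\}$. A nonempty word $w$ is a solution with parameters $(\mathfrak a,\mathfrak b)$ if $w^2\in\Pi(\mathfrak a,\mathfrak b)$ and $w$ can be written as $w=X_1\cdots X_n$ with $X_i\in\{S_1,\dots,S_6\}$ such that $X_1^2\cdots X_n^2=(X_1\cdots X_n)^2$. *)

theory Defs
  imports
    "HOL-Library.Z2"
    "HOL-Library.Stream"
    "HOL-Library.Sublist"
    "HOL-Number_Theory.Number_Theory"
begin

type_synonym word01 = "bit list"

abbreviation word_pow :: "word01 \<Rightarrow> nat \<Rightarrow> word01" where
  "word_pow u k \<equiv> concat (replicate k u)"

definition S1 :: word01 where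
  "S1 = [0]"

definition S2 :: "nat \<Rightarrow> word01" where
  "S2 a = [0, 1] @ word_pow [0] (a - 1)"

definition S3 :: "nat \<Rightarrow> word01" where
  "S3 a = [0, 1] @ word_pow [0] a"

definition S4 :: "nat \<Rightarrow> word01" where
  "S4 a = [1] @ word_pow [0] a"

definition S5 :: "nat \<Rightarrow> nat \<Rightarrow> word01" where
  "S5 a b = [1] @ word_pow [0] (a + 1) @ word_pow ([1] @ word_pow [0] a) b"

definition S6 :: "nat \<Rightarrow> nat \<Rightarrow> word01" where
  "S6 a b = [1] @ word_pow [0] (a + 1) @ word_pow ([1] @ word_pow [0] a) (b + 1)"

definition roots :: "nat \<Rightarrow> nat \<Rightarrow> word01 set" where
  "roots a b = {S1, S2 a, S3 a, S4 a, S5 a b, S6 a b}"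

(* stake (length u) (sdrop i (flat s)) is the factor of length |u| at position i of the
   infinite concatenation of the words in s. *)
definition lang :: "nat \<Rightarrow> nat \<Rightarrow> word01 set" where
  "lang a b = {u. \<exists>s i. sset s \<subseteq> {S5 a b, S6 a b} \<and> u = stake (length u) (sdrop i (flat s))}"

definition square_product :: "word01 list \<Rightarrow> word01" where
  "square_product Xs = concat (map (\<lambda>X. word_pow X 2) Xs)"

definition Pi_words :: "nat \<Rightarrow> nat \<Rightarrow> word01 set" where
  "Pi_words a b =
     {u. u \<noteq> [] \<and> u \<in> lang a b \<and> (\<exists>Xs. set Xs \<subseteq> roots a b \<and> u = square_product Xs)}"

definition is_solution :: "nat \<Rightarrow> nat \<Rightarrow> word01 \<Rightarrow> bool" where
  "is_solution a b w \<longleftrightarrow>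
     w \<noteq> [] \<and> word_pow w 2 \<in> Pi_words a b \<and>
     (\<exists>Xs. set Xs \<subseteq> roots a b \<and> w = concat Xs \<and> square_product Xs = word_pow (concat Xs) 2)"

definition solutions_of_length :: "nat \<Rightarrow> word01 set" where
  "solutions_of_length n =
     {w. length w = n \<and> hd w = 0 \<and> \<not> sublist [1, 1] w \<and>
         (\<exists>a b. a \<ge> 1 \<and> is_solution a b w)}"

definition num_divisors :: "nat \<Rightarrow> nat" where
  "num_divisors k = card {e. e dvd k}"

definition doubling_orbit_rel :: "nat \<Rightarrow> (nat \<times> nat) set" where
  "doubling_orbit_rel l =
     {(i, j). i < l \<and> j < l \<and> (\<exists>k1 k2. [2 ^ k1 * i = 2 ^ k2 * j] (mod l))}"

definition num_orbits :: "nat \<Rightarrow> nat" where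
  "num_orbits l = card ({0..<l} // doubling_orbit_rel l)"

(* Only used for d dvd n with d > 2; then num_orbits (n div d) \<ge> 1, so the truncated
   subtractions in the exponent and in d - 1 are genuine ones. *)
definition H_count :: "nat \<Rightarrow> nat \<Rightarrow> real" where
  "H_count n d =
     (2 ^ (num_orbits (n div d) - 1) - 1) *
     (real (totient d) / 2 - real (num_divisors (d - 1)) + 1)"

end

theory Submission
  imports Defs
begin

text \<open>Let \<open>w\<close> have length \<open>n\<close> and \<open>k\<close> ones, and give the letters weights for which \<open>w\<close> has total
  weight \<open>0\<close>; the height of a position of \<open>w w w \<dots>\<close> is the weight of the prefix before it. If
  \<open>w = X\<^sub>1 \<cdots> X\<^sub>m\<close> and \<open>w w = X\<^sub>1 X\<^sub>1 \<cdots> X\<^sub>m X\<^sub>m\<close>, then at each breakpoint \<open>p\<close> the height at \<open>2p\<close> is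
  twice the height at \<open>p\<close>. Comparing extreme heights shows that no height exceeds the weight of the
  letter \<open>1\<close> or falls below that of \<open>0\<close>. Since heights are determined modulo \<open>n\<close>, such a word is
  determined by its letters at the multiples of \<open>d = n / gcd n k\<close>: it is a product of copies of a
  reversed standard word \<open>01u\<close> of length \<open>d\<close> and of \<open>10u\<close>. All these multiples are breakpoints, so
  the pattern \<open>x\<close> of the blocks satisfies \<open>x (2i mod g) = x i\<close> with \<open>g = gcd n k\<close>, that is, it is
  constant on the orbits of doubling.

  Conversely, if a word with such a pattern lies in a language, then greedily halving the squares
  read along \<open>w w\<close> yields the factorization. A Euclidean division of \<open>n\<close> by \<open>k\<close> and then of \<open>k\<close> by the
  remainder gives the parameters of a language, except that a nonconstant pattern is impossible
  if \<open>k / g\<close> divides \<open>d - 1\<close>, because two gaps between long runs of zeros would then differ by \<open>2\<close>.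
  Summing the number of patterns over \<open>k \<le> n / 2\<close> gives the formula.\<close>

section \<open>Occurrences of finite words in an infinite word\<close>

definition occurs :: "(nat \<Rightarrow> bit) \<Rightarrow> nat \<Rightarrow> word01 \<Rightarrow> bool" where
  "occurs V t u \<longleftrightarrow> (\<forall>i<length u. V (t + i) = u ! i)"

lemma occurs_Nil [simp]: "occurs V t []"
  by (simp add: occurs_def)

lemma occurs_Cons [simp]: "occurs V t (x # u) \<longleftrightarrow> V t = x \<and> occurs V (Suc t) u"
  by (auto simp: occurs_def All_less_Suc2)

lemma occurs_append [simp]:
  "occurs V t (u @ v) \<longleftrightarrow> occurs V t u \<and> occurs V (t + length u) v"
proof (induction u arbitrary: t)
  case (Cons x u)
  show ?case by (simp add: Cons.IH conj_assoc)
qed simp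

lemma occurs_replicate: "occurs V t (replicate m x) \<longleftrightarrow> (\<forall>i<m. V (t + i) = x)"
  by (auto simp: occurs_def)

lemma occurs_iff_map: "occurs V t u \<longleftrightarrow> map V [t..<t + length u] = u"
  unfolding occurs_def list_eq_iff_nth_eq by simp

lemma occurs_map [simp]: "occurs V t (map V [t..<t + m])"
  by (simp add: occurs_def)

lemma occurs_take: "occurs V t u \<Longrightarrow> occurs V t (take s u)"
  by (simp add: occurs_def)

lemma occurs_snth: "occurs (snth s) t u \<longleftrightarrow> stake (length u) (sdrop t s) = u"
  unfolding occurs_def list_eq_iff_nth_eq by (simp add: sdrop_snth)

lemma occurs_sdrop_shift: "sdrop t s = u @- s' \<Longrightarrow> occurs (snth s) t u"
  by (simp add: occurs_snth stake_shift)

subsection \<open>Heights\<close>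

text \<open>This is \<open>n\<close> times the letter minus the density \<open>k / n\<close>, scaled
  to keep heights integral: a height is \<open>n\<close> times the surplus of ones in a prefix over
  the expected number.\<close>

definition letter_weight :: "nat \<Rightarrow> nat \<Rightarrow> bit \<Rightarrow> int" where
  "letter_weight n k x = (if x = 1 then int n - int k else - int k)"

definition weight :: "nat \<Rightarrow> nat \<Rightarrow> word01 \<Rightarrow> int" where
  "weight n k u = sum_list (map (letter_weight n k) u)"

definition height :: "nat \<Rightarrow> nat \<Rightarrow> (nat \<Rightarrow> bit) \<Rightarrow> nat \<Rightarrow> int" where
  "height n k V t = weight n k (map V [0..<t])"

lemma letter_weight_simps [simp]:
  "letter_weight n k 1 = int n - int k" "letter_weight n k 0 = - int k"
  by (auto simp: letter_weight_def)

lemma weight_simps [simp]: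
  "weight n k [] = 0"
  "weight n k (x # u) = letter_weight n k x + weight n k u"
  "weight n k (u @ v) = weight n k u + weight n k v"
  by (auto simp: weight_def)

lemma weight_replicate [simp]: "weight n k (replicate m 0) = - int m * int k"
  by (induction m) (auto simp: algebra_simps)

lemma weight_concat_replicate [simp]:
  "weight n k (concat (replicate m u)) = int m * weight n k u"
  by (induction m) (auto simp: algebra_simps)

lemma height_0 [simp]: "height n k V 0 = 0"
  by (simp add: height_def)

lemma height_Suc: "height n k V (Suc t) = height n k V t + letter_weight n k (V t)"
  by (simp add: height_def)

lemma height_occurs:
  assumes "occurs V t u"
  shows "height n k V (t + length u) = height n k V t + weight n k u"
proof -
  have "[0..<t + length u] = [0..<t] @ [t..<t + length u]"
    by (rule upt_add_eq_append) simp
  then show ?thesis using assms by (simp add: height_def occurs_iff_map)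
qed

lemma height_occurs_take:
  assumes "occurs V t u" "s \<le> length u"
  shows "height n k V (t + s) = height n k V t + weight n k (take s u)"
  using height_occurs[OF occurs_take[OF assms(1), of s], of n k] assms(2) by simp

lemma weight_count: "weight n k u = int n * int (count_list u 1) - int k * int (length u)"
proof (induction u)
  case (Cons x u)
  then show ?case by (cases x) (auto simp: algebra_simps letter_weight_def)
qed auto

text \<open>The height is \<open>n\<close> times a number of ones minus \<open>k * t\<close>, so its
  residue depends on the position alone and not on the letters.\<close>

lemma height_cong_mod: "int n dvd height n k V t + int k * int t"
  by (simp add: height_def weight_count)

lemma height_periodic:
  assumes "\<And>t. V (t + n) = V t" "height n k V n = 0"
  shows "height n k V (t + n) = height n k V t"
  by (induction t) (auto simp: height_Suc assms)

lemma periodic_mod: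
  assumes "\<And>t. f (t + n) = f t"
  shows "f (t mod n) = f (t :: nat)"
proof -
  have "f (t + m * n) = f t" for m t
  proof (induction m)
    case (Suc m)
    have "f (t + Suc m * n) = f (t + m * n + n)" by (simp add: algebra_simps)
    then show ?case using assms Suc by simp
  qed simp
  from this[of "t mod n" "t div n"] show ?thesis by simp
qed

lemma height_mod:
  assumes "\<And>t. V (t + n) = V t" "height n k V n = 0"
  shows "height n k V (t mod n) = height n k V t"
  using assms by (intro periodic_mod height_periodic)

subsection \<open>The roots\<close>

text \<open>\<open>long_block a c\<close> is the common shape of \<open>S5\<close> (\<open>c = b\<close>) and \<open>S6\<close> (\<open>c = b + 1\<close>).\<close>

definition short_block :: "nat \<Rightarrow> word01" where
  "short_block a = 1 # replicate a 0"

definition long_block :: "nat \<Rightarrow> nat \<Rightarrow> word01" where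
  "long_block a c = 1 # replicate (a + 1) 0 @ concat (replicate c (short_block a))"

lemma concat_replicate_single [simp]: "concat (replicate m [x]) = replicate m x"
  by (induction m) auto

lemma roots_eq:
  "roots a b = {[0], [0, 1] @ replicate (a - 1) 0, [0, 1] @ replicate a 0,
     short_block a, long_block a b, long_block a (b + 1)}"
  by (simp add: roots_def S1_def S2_def S3_def S4_def S5_def S6_def short_block_def
      long_block_def insert_commute)

lemma S56_eq: "{S5 a b, S6 a b} = {long_block a b, long_block a (b + 1)}"
  by (simp add: S5_def S6_def short_block_def long_block_def)

lemma length_short_block [simp]: "length (short_block a) = a + 1"
  by (simp add: short_block_def)

lemma length_concat_replicate [simp]: "length (concat (replicate m u)) = m * length u"
  by (induction m) auto

lemma length_long_block [simp]: "length (long_block a c) = a + 2 + c * (a + 1)"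
  by (simp add: long_block_def)

lemma weight_short_block [simp]: "weight n k (short_block a) = int n - (int a + 1) * int k"
  by (simp add: short_block_def algebra_simps)

lemma weight_long_block [simp]:
  "weight n k (long_block a c) =
     int n - (int a + 2) * int k + int c * (int n - (int a + 1) * int k)"
  by (simp add: long_block_def algebra_simps)

text \<open>A recursion that carries the current height lets the simplifier evaluate conditions on
  roots whose exponents are variables.\<close>

primrec all_prefixes :: "(int \<Rightarrow> bit \<Rightarrow> bool) \<Rightarrow> nat \<Rightarrow> nat \<Rightarrow> int \<Rightarrow> word01 \<Rightarrow> bool" where
  "all_prefixes Q n k h [] = True"
| "all_prefixes Q n k h (x # u) = (Q h x \<and> all_prefixes Q n k (h + letter_weight n k x) u)"

lemma all_prefixes_iff:
  "all_prefixes Q n k h u \<longleftrightarrow> (\<forall>s<length u. Q (h + weight n k (take s u)) (u ! s))"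
  by (induction u arbitrary: h) (auto simp: All_less_Suc2 add.assoc)

lemma all_prefixes_append [simp]:
  "all_prefixes Q n k h (u @ v) \<longleftrightarrow>
     all_prefixes Q n k h u \<and> all_prefixes Q n k (h + weight n k u) v"
  by (induction u arbitrary: h) (auto simp: add.assoc)

lemma all_prefixes_replicate [simp]:
  "all_prefixes Q n k h (replicate m 0) \<longleftrightarrow> (\<forall>i<m. Q (h - int i * int k) 0)"
  by (induction m arbitrary: h) (auto simp: All_less_Suc2 algebra_simps)

lemma all_prefixes_concat_replicate [simp]:
  "all_prefixes Q n k h (concat (replicate m u)) \<longleftrightarrow>
     (\<forall>j<m. all_prefixes Q n k (h + int j * weight n k u) u)"
  by (induction m arbitrary: h) (auto simp: All_less_Suc2 algebra_simps)

subsection \<open>The language\<close>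

lemma concat_replicate_Suc_right: "concat (replicate (Suc m) u) = concat (replicate m u) @ u"
  by (induction m) auto

definition long_blocks :: "nat \<Rightarrow> nat \<Rightarrow> word01 set" where
  "long_blocks a b = {long_block a b, long_block a (b + 1)}"

lemma flat_long_blocks:
  assumes "sset s \<subseteq> long_blocks a b"
  obtains c s' where "c = b \<or> c = b + 1" "sset s' \<subseteq> long_blocks a b"
    "flat s = long_block a c @- flat s'"
proof -
  obtain X s' where s: "s = X ## s'" by (cases s)
  obtain c where c: "c = b \<or> c = b + 1" and X: "X = long_block a c"
    using assms s by (auto simp: long_blocks_def)
  have "flat s = long_block a c @- flat s'"
    unfolding s X by (subst flat_Stream) (auto simp: long_block_def)
  with that c assms s show ?thesis by auto
qed

text \<open>A cut inside a long block leaves the rest of a run of zeros and then the remaining short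
  blocks. This normal form survives the removal of one more letter.\<close>

lemma flat_tail:
  assumes "sset s \<subseteq> long_blocks a b"
  shows "\<exists>i c s'. i \<le> a + 1 \<and> sset s' \<subseteq> long_blocks a b \<and>
    sdrop t (flat s) =
      replicate i 0 @- concat (replicate c (short_block a)) @- flat s'"
proof (induction t)
  case 0
  show ?case using assms
    by (intro exI[of _ "0::nat"] exI[of _ s]) simp
next
  case (Suc t)
  then obtain i c s' where i: "i \<le> a + 1" and s': "sset s' \<subseteq> long_blocks a b"
    and eq: "sdrop t (flat s) =
      replicate i 0 @- concat (replicate c (short_block a)) @- flat s'"
    by blast
  have next_tail: "sdrop (Suc t) (flat s) = stl (sdrop t (flat s))"
    by (simp add: sdrop_stl)
  show ?case
  proof (cases i)
    case (Suc i')
    then have "sdrop (Suc t) (flat s) =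
        replicate i' 0 @- concat (replicate c (short_block a)) @- flat s'"
      unfolding next_tail eq by simp
    then show ?thesis using i s' Suc by (intro exI[of _ i'] exI[of _ c] exI[of _ s']) simp
  next
    case i0: 0
    show ?thesis
    proof (cases c)
      case (Suc c')
      then have "sdrop (Suc t) (flat s) =
          replicate a 0 @- concat (replicate c' (short_block a)) @- flat s'"
        unfolding next_tail eq i0 by (simp add: short_block_def)
      then show ?thesis using s' by (intro exI[of _ a] exI[of _ c'] exI[of _ s']) simp
    next
      case 0
      obtain d s'' where s'': "sset s'' \<subseteq> long_blocks a b" "flat s' = long_block a d @- flat s''"
        using flat_long_blocks[OF s'] by metis
      have "sdrop (Suc t) (flat s) =
          replicate (a + 1) 0 @- concat (replicate d (short_block a)) @- flat s''"
        unfolding next_tail eq i0 0 s'' by (simp add: long_block_def)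
      then show ?thesis using s''(1)
        by (intro exI[of _ "a + 1"] exI[of _ d] exI[of _ s'']) simp
    qed
  qed
qed

text \<open>A long block is itself a short block, one more zero, and further short blocks.\<close>

lemma block_tail_begins_short:
  assumes "sset s \<subseteq> long_blocks a b"
  obtains T where "concat (replicate c (short_block a)) @- flat s = short_block a @- T"
proof (cases c)
  case (Suc c')
  then show ?thesis using that by simp
next
  case 0
  obtain d s' where "flat s = long_block a d @- flat s'"
    using flat_long_blocks[OF assms] by metis
  moreover have "long_block a d = short_block a @ 0 # concat (replicate d (short_block a))"
    by (simp add: long_block_def short_block_def replicate_app_Cons_same)
  ultimately have "concat (replicate c (short_block a)) @- flat s =
      short_block a @- 0 ## concat (replicate d (short_block a)) @- flat s'"
    using 0 by simp
  with that show ?thesis by blast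
qed

lemma flat_one_cases:
  assumes "sset s \<subseteq> long_blocks a b" "flat s !! t = 1"
  obtains c s' where "sset s' \<subseteq> long_blocks a b"
    "sdrop t (flat s) = concat (replicate c (short_block a)) @- flat s'"
proof -
  obtain i c s' where *: "sset s' \<subseteq> long_blocks a b"
    "sdrop t (flat s) = replicate i 0 @- concat (replicate c (short_block a)) @- flat s'"
    using flat_tail[OF assms(1)] by metis
  have "shd (sdrop t (flat s)) = 1" using assms(2) by simp
  then have "i = 0" unfolding *(2) by (cases i) auto
  with that * show ?thesis by simp
qed

lemma flat_zeros_after_one:
  assumes "sset s \<subseteq> long_blocks a b" "flat s !! t = 1" "1 \<le> j" "j \<le> a"
  shows "flat s !! (t + j) = 0"
proof -
  obtain T where "sdrop t (flat s) = short_block a @- T"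
    using assms(1,2) by (metis flat_one_cases block_tail_begins_short)
  then have "occurs (snth (flat s)) t (short_block a)" by (rule occurs_sdrop_shift)
  then show ?thesis using assms(3,4)
    by (cases j) (auto simp: short_block_def occurs_replicate)
qed

lemma flat_one_in_window:
  assumes "sset s \<subseteq> long_blocks a b"
  shows "\<exists>j\<le>a + 1. flat s !! (t + j) = 1"
proof -
  obtain i c s' where *: "i \<le> a + 1" "sset s' \<subseteq> long_blocks a b"
    "sdrop t (flat s) = replicate i 0 @- concat (replicate c (short_block a)) @- flat s'"
    using flat_tail[OF assms] by metis
  obtain T where "concat (replicate c (short_block a)) @- flat s' = short_block a @- T"
    using block_tail_begins_short[OF *(2)] .
  then have "sdrop t (flat s) = (replicate i 0 @ short_block a) @- T"
    using *(3) by simp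
  then have "occurs (snth (flat s)) t (replicate i 0 @ short_block a)"
    by (rule occurs_sdrop_shift)
  then have "flat s !! (t + i) = 1" by (simp add: short_block_def)
  then show ?thesis using *(1) by blast
qed

text \<open>The extra zero that ends the first word stands \<open>a + 1\<close> letters after a one,
  where the second word would have a one if it had more than \<open>j\<close> short blocks.\<close>

lemma short_run_length_le:
  assumes "occurs V t (concat (replicate j (short_block a)) @ 1 # replicate (a + 1) 0)"
    and "occurs V t (concat (replicate c (short_block a)) @ [1])"
  shows "c \<le> j"
proof (rule ccontr)
  assume "\<not> c \<le> j"
  have one: "V (t + i * (a + 1)) = 1" if "i \<le> c" for i
  proof -
    have "concat (replicate c (short_block a)) =
        concat (replicate i (short_block a)) @ concat (replicate (c - i) (short_block a))"
      using that by (simp flip: concat_append replicate_add)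
    then show ?thesis using assms(2) that
      by (cases "c - i") (auto simp: short_block_def)
  qed
  have "occurs V (t + j * (a + 1)) (1 # replicate (a + 1) 0)" using assms(1) by simp
  then have "V (Suc (t + j * (a + 1)) + a) = 0"
    unfolding occurs_Cons occurs_replicate by simp
  moreover have "Suc (t + j * (a + 1)) + a = t + (j + 1) * (a + 1)" by simp
  ultimately show False using one[of "j + 1"] \<open>\<not> c \<le> j\<close> by (simp add: add.commute add.left_commute)
qed

text \<open>Long runs of zeros mark the starts of long blocks, so a stretch from one long run to the
  next is exactly one block of the concatenation.\<close>

lemma flat_short_runs:
  assumes "sset s \<subseteq> long_blocks a b" "occurs (snth (flat s)) t (long_block a j @ 1 # replicate (a + 1) 0)"
  shows "j = b \<or> j = b + 1"
proof -
  have start: "occurs (snth (flat s)) t (1 # replicate (a + 1) 0)"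
    and rest: "occurs (snth (flat s)) (t + (a + 2))
      (concat (replicate j (short_block a)) @ 1 # replicate (a + 1) 0)"
    using assms(2) by (simp_all add: long_block_def)
  then have "flat s !! t = 1" by simp
  then obtain c s1 where s1: "sset s1 \<subseteq> long_blocks a b"
    "sdrop t (flat s) = concat (replicate c (short_block a)) @- flat s1"
    using flat_one_cases[OF assms(1)] by metis
  \<comment> \<open>A pending short block would put a one \<open>a + 1\<close> letters after
    \<open>t\<close>, inside the long run of zeros.\<close>
  have "c = 0"
  proof (rule ccontr)
    assume "c \<noteq> 0"
    then obtain c' where c': "c = Suc c'" by (cases c) auto
    obtain T where T: "concat (replicate c' (short_block a)) @- flat s1 = short_block a @- T"
      using block_tail_begins_short[OF s1(1)] .
    have "sdrop t (flat s) = (short_block a @ short_block a) @- T"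
      using s1(2) T c' by simp
    then have "occurs (snth (flat s)) t (short_block a @ short_block a)"
      by (rule occurs_sdrop_shift)
    then have "flat s !! (t + (a + 1)) = 1" by (simp add: short_block_def)
    moreover have "flat s !! (Suc t + a) = 0"
      using start unfolding occurs_Cons occurs_replicate by simp
    ultimately show False by simp
  qed
  obtain d s2 where s2: "d = b \<or> d = b + 1" "sset s2 \<subseteq> long_blocks a b"
    "flat s1 = long_block a d @- flat s2"
    using flat_long_blocks[OF s1(1)] by metis
  obtain e s3 where s3: "flat s2 = long_block a e @- flat s3"
    using flat_long_blocks[OF s2(2)] by metis
  have "sdrop t (flat s) = (long_block a d @ long_block a e) @- flat s3"
    using s1(2) \<open>c = 0\<close> s2(3) s3 by simp
  then have "occurs (snth (flat s)) t (long_block a d @ long_block a e)"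
    by (rule occurs_sdrop_shift)
  then have d_occ: "occurs (snth (flat s)) (t + (a + 2))
      (concat (replicate d (short_block a)) @ 1 # replicate (a + 1) 0)"
    by (simp add: long_block_def)
  have "d \<le> j"
    by (rule short_run_length_le[OF rest]) (use d_occ in simp)
  moreover have "j \<le> d"
    by (rule short_run_length_le[OF d_occ]) (use rest in simp)
  ultimately show ?thesis using s2(1) by simp
qed

text \<open>This makes the greedy factorization possible: wherever the reading of \<open>w w\<close>
  has stopped, the square of a root can be split off.\<close>

lemma flat_root_square:
  assumes s: "sset s \<subseteq> long_blocks a b" and a: "1 \<le> a"
  shows "\<exists>X\<in>roots a b. occurs (snth (flat s)) t (X @ X)"
proof -
  obtain i c s' where i: "i \<le> a + 1" and s': "sset s' \<subseteq> long_blocks a b"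
    and eq: "sdrop t (flat s) = replicate i 0 @- concat (replicate c (short_block a)) @- flat s'"
    using flat_tail[OF s] by metis
  have concl: ?thesis
    if "X \<in> roots a b" "sdrop t (flat s) = (X @ X @ u) @- T" for X u T
    using occurs_sdrop_shift[OF that(2)] that(1) by auto
  obtain a' where a': "a = Suc a'" using a by (cases a) auto
  obtain T where T: "concat (replicate c (short_block a)) @- flat s' = short_block a @- T"
    using block_tail_begins_short[OF s'] .
  obtain d s2 where s2: "d = b \<or> d = b + 1" "sset s2 \<subseteq> long_blocks a b"
    "flat s' = long_block a d @- flat s2"
    using flat_long_blocks[OF s'] by metis
  obtain T2 where T2: "concat (replicate d (short_block a)) @- flat s2 = short_block a @- T2"
    using block_tail_begins_short[OF s2(2)] .
  \<comment> \<open>Here \<open>i\<close> zeros precede the next one, and \<open>c\<close> short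
    blocks precede the next long block. The five cases yield squares of \<open>S1\<close>,
    \<open>S2 a\<close>, \<open>S3 a\<close>, \<open>S4 a\<close>, and of \<open>S5 a b\<close> or
    \<open>S6 a b\<close>.\<close>
  consider "2 \<le> i" | "i = 1" "c \<noteq> 0" | "i = 1" "c = 0" | "i = 0" "c \<noteq> 0" | "i = 0" "c = 0"
    by linarith
  then show ?thesis
  proof cases
    case 1
    define i' where "i' = i - 2"
    have "i = Suc (Suc i')" using 1 by (simp add: i'_def)
    then show ?thesis using eq
      by (intro concl[of "[0]" "replicate i' 0"]) (auto simp: roots_eq)
  next
    case 2
    then obtain c' where c': "c = Suc c'" by (cases c) auto
    obtain T' where T': "concat (replicate c' (short_block a)) @- flat s' = short_block a @- T'"
      using block_tail_begins_short[OF s'] .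
    have "sdrop t (flat s) = (0 # short_block a @ short_block a) @- T'"
      using eq 2(1) c' T' by simp
    also have "0 # short_block a @ short_block a =
        ([0, 1] @ replicate (a - 1) 0) @ ([0, 1] @ replicate (a - 1) 0) @ [0]"
      by (simp add: short_block_def a' replicate_append_same replicate_app_Cons_same)
    finally show ?thesis by (rule concl[rotated]) (simp add: roots_eq)
  next
    case 3
    have "sdrop t (flat s) = (0 # 1 # replicate (a + 1) 0 @ short_block a) @- T2"
      using eq 3 s2(3) T2 by (simp add: long_block_def)
    also have "0 # 1 # replicate (a + 1) 0 @ short_block a =
        ([0, 1] @ replicate a 0) @ ([0, 1] @ replicate a 0) @ []"
      by (simp add: short_block_def replicate_app_Cons_same)
    finally show ?thesis by (rule concl[rotated]) (simp add: roots_eq)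
  next
    case 4
    then obtain c' where c': "c = Suc c'" by (cases c) auto
    obtain T' where T': "concat (replicate c' (short_block a)) @- flat s' = short_block a @- T'"
      using block_tail_begins_short[OF s'] .
    have "sdrop t (flat s) = (short_block a @ short_block a @ []) @- T'"
      using eq 4(1) c' T' by simp
    then show ?thesis by (rule concl[rotated]) (simp add: roots_eq)
  next
    case 5
    obtain e s3 where s3: "e = b \<or> e = b + 1" "sset s3 \<subseteq> long_blocks a b"
      "flat s2 = long_block a e @- flat s3"
      using flat_long_blocks[OF s2(2)] by metis
    obtain T3 where T3: "flat s3 = short_block a @- T3"
      using block_tail_begins_short[OF s3(2), of 0] by auto
    have extend: "long_block a (Suc m) = long_block a m @ short_block a" for m
      by (simp add: long_block_def concat_replicate_Suc_right del: replicate.simps)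
    have tail: "sdrop t (flat s) = long_block a d @- long_block a e @- flat s3"
      using eq 5 s2(3) s3(3) by simp
    \<comment> \<open>Equal blocks form a square. If \<open>d < e\<close>, the second block has the
      first as a prefix; if \<open>d > e\<close>, it is completed by the short block that begins the
      block after it.\<close>
    have "\<exists>u T. sdrop t (flat s) = (long_block a d @ long_block a d @ u) @- T"
      using s2(1) s3(1)
    proof (elim disjE)
      assume "d = b" "e = b + 1"
      then show ?thesis using tail extend[of b]
        by (intro exI[of _ "short_block a"] exI[of _ "flat s3"]) simp
    next
      assume "d = b + 1" "e = b"
      then show ?thesis using tail T3 extend[of b]
        by (intro exI[of _ "[]"] exI[of _ T3]) simp
    qed (use tail in \<open>metis append_Nil2 shift_append\<close>)+
    then obtain u T' where "sdrop t (flat s) = (long_block a d @ long_block a d @ u) @- T'"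
      by blast
    then show ?thesis by (rule concl[rotated]) (use s2(1) in \<open>auto simp: roots_eq\<close>)
  qed
qed

subsection \<open>Heights inside a root\<close>

text \<open>\<open>H\<close> is the weight of a short block, so the short blocks inside start at
  \<open>H - k + j * H\<close> relative to the beginning. The second part omits the first letter,
  for claims about inner positions only.\<close>

lemma all_prefixes_long_block:
  fixes H :: int
  assumes "int n = H + (int a + 1) * int k"
  shows "all_prefixes Q n k h (long_block a c) \<longleftrightarrow> Q h 1 \<and>
    (\<forall>i\<le>a. Q (h + int n - int k - int i * int k) 0) \<and>
    (\<forall>j<c. Q (h + H - int k + int j * H) 1 \<and>
      (\<forall>i<a. Q (h + H - int k + int j * H + int n - int k - int i * int k) 0))"
    (is ?A)
    and "all_prefixes Q n k h (tl (long_block a c)) \<longleftrightarrow>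
    (\<forall>i\<le>a. Q (h - int i * int k) 0) \<and>
    (\<forall>j<c. Q (h - (int a + 1) * int k + int j * H) 1 \<and>
      (\<forall>i<a. Q (h - (int a + 1) * int k + int j * H + int n - int k - int i * int k) 0))"
    (is ?B)
proof -
  have tl: "tl (long_block a c) =
      replicate (a + 1) 0 @ concat (replicate c (short_block a))" for c
    by (simp add: long_block_def)
  have H: "weight n k (short_block a) = H" using assms by simp
  have short: "all_prefixes Q n k h (short_block a) \<longleftrightarrow>
      Q h 1 \<and> (\<forall>i<a. Q (h + int n - int k - int i * int k) 0)" for h
    by (simp add: short_block_def algebra_simps)
  have B: "all_prefixes Q n k h (tl (long_block a c)) \<longleftrightarrow>
    (\<forall>i\<le>a. Q (h - int i * int k) 0) \<and>
    (\<forall>j<c. Q (h - (int a + 1) * int k + int j * H) 1 \<and>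
      (\<forall>i<a. Q (h - (int a + 1) * int k + int j * H + int n - int k - int i * int k) 0))" for h
    unfolding tl all_prefixes_append all_prefixes_replicate all_prefixes_concat_replicate
      short H weight_replicate
    by (simp add: less_Suc_eq_le algebra_simps del: replicate.simps)
  then show ?B .
  have "all_prefixes Q n k h (long_block a c) \<longleftrightarrow>
      Q h 1 \<and> all_prefixes Q n k (h + (int n - int k)) (tl (long_block a c))"
    by (simp add: long_block_def)
  moreover have "h + (int n - int k) - (int a + 1) * int k = h + H - int k"
    using assms by simp
  ultimately show ?A unfolding B by (simp add: algebra_simps)
qed

lemma weight_long_block_H:
  assumes "int n = H + (int a + 1) * int k"
  shows "weight n k (long_block a c) = H - int k + int c * H"
  using assms by (simp add: algebra_simps)

text \<open>A height may be compared with either end of the root. In a long block the low points are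
  bounded from the start, while the short blocks climb by \<open>H \<ge> 0\<close> each, so their
  peaks are bounded from the end.\<close>

lemma root_height_bounds:
  assumes X: "X \<in> roots a b" and a: "1 \<le> a" and n: "(a + 1) * k \<le> n"
  shows "all_prefixes (\<lambda>h x.
      (h \<le> int n - int k \<or> h \<le> weight n k X + int n - int k) \<and>
      (- int k \<le> h \<or> weight n k X - int k \<le> h)) n k 0 X"
proof -
  define H where "H = int n - (int a + 1) * int k"
  have nH: "int n = H + (int a + 1) * int k" by (simp add: H_def)
  have "int ((a + 1) * k) \<le> int n" using n by (simp only: of_nat_le_iff)
  then have H: "0 \<le> H" by (simp add: H_def algebra_simps)
  have ik: "int i * int k \<le> int m * int k" if "i \<le> m" for i m
    using that by (simp add: mult_right_mono)
  have iH: "int i * H \<le> int m * H" if "i \<le> m" for i m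
    using that H by (simp add: mult_right_mono)
  have nk: "int n - int k = H + int a * int k" by (simp add: nH algebra_simps)
  have kn: "int k \<le> int n" using nH H by (simp add: algebra_simps)
  consider "X = [0]" | m where "X = [0, 1] @ replicate m 0" | "X = short_block a"
    | c where "X = long_block a c"
    using X by (auto simp: roots_eq)
  then show ?thesis
  proof cases
    case 2
    have w: "weight n k X = int n - 2 * int k - int m * int k" unfolding 2 by simp
    have step: "0 \<le> int i * int k" "int i * int k \<le> int m * int k" if "i < m" for i
      using ik[of i m] that by simp_all
    have "0 \<le> int m * int k" by simp
    then show ?thesis
      unfolding w unfolding 2
      by (auto simp: diff_le_eq intro: step order_trans[OF _ kn])
        (use kn in simp, use step in force)
  next
    case 3
    have "int n - int k - int i * int k \<ge> 0" if "i < a" for i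
      using ik[of i a] that nk H by simp
    then show ?thesis unfolding 3 short_block_def all_prefixes.simps all_prefixes_replicate
        letter_weight_simps
      using kn by (intro conjI allI impI disjI1) fastforce+
  next
    case 4
    have z: "0 \<le> int n - int k - int i * int k" if "i \<le> a" for i
      using ik[of i a] that nk H by simp
    have z': "int i * int k \<ge> 0" for i by simp
    have j: "0 \<le> int j * H" "int j * H \<le> int c * H" if "j < c" for j
      using iH[of j c] H that by simp_all
    show ?thesis
      unfolding 4 all_prefixes_long_block(1)[OF nH] weight_long_block_H[OF nH]
    proof (intro conjI allI impI, goal_cases)
      case (3 i) then show ?case using z'[of i] by linarith
    next
      case (4 i) then show ?case using z[OF 4] by linarith
    next
      case (5 j) then show ?case using j[OF 5] kn by linarith
    next
      case (6 j) then show ?case using j[OF 6] H by linarith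
    next
      case (7 j i) then show ?case using j[OF 7(1)] H z'[of i] by linarith
    next
      case (8 j i) then show ?case using j[OF 8(1)] H z[OF less_imp_le[OF 8(2)]] by linarith
    qed (use kn in auto)
  qed (use kn in auto)
qed

text \<open>Let \<open>w\<close> and \<open>W\<close> be the weights of the prefix and of
  \<open>X\<close>. Then \<open>y + 2 * w\<close> is both \<open>(y + w) + w\<close> and
  \<open>(y + W + w) + (w - W)\<close>. In each form \<open>sq\<close> gives the weak sign of the
  first summand, and for every inner letter one of the second summands has that sign
  strictly.\<close>

lemma root_square_strict:
  assumes X: "X \<in> roots a b" and a: "1 \<le> a" and k: "0 < k" and n: "(a + 1) * k \<le> n"
    and n': "X \<in> long_blocks a b \<Longrightarrow> (a + 1) * k < n"
    and sq: "\<And>s. s < length X \<Longrightarrow>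
      (if X ! s = 1
       then y + weight n k (take s X) \<le> 0 \<and> y + weight n k X + weight n k (take s X) \<le> 0
       else 0 \<le> y + weight n k (take s X) \<and> 0 \<le> y + weight n k X + weight n k (take s X))"
    and s: "0 < s" "s < length X"
  shows "if X ! s = 1 then y + 2 * weight n k (take s X) < 0
         else 0 < y + 2 * weight n k (take s X)"
proof -
  define H where "H = int n - (int a + 1) * int k"
  have nH: "int n = H + (int a + 1) * int k" by (simp add: H_def)
  have "int ((a + 1) * k) \<le> int n" using n by (simp only: of_nat_le_iff)
  then have H: "0 \<le> H" by (simp add: H_def algebra_simps)
  have ik: "int i * int k \<le> int m * int k" if "i \<le> m" for i m
    using that by (simp add: mult_right_mono)
  have nk: "int n - int k = H + int a * int k" by (simp add: nH algebra_simps)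
  let ?P = "\<lambda>h x. if x = 1 then y + h \<le> 0 \<and> y + weight n k X + h \<le> 0
       else 0 \<le> y + h \<and> 0 \<le> y + weight n k X + h"
  let ?Q = "\<lambda>h x. if x = 1 then y + 2 * h < 0 else 0 < y + 2 * h"
  have P: "all_prefixes ?P n k 0 X" using sq by (simp add: all_prefixes_iff)
  have ne: "X \<noteq> []" using s by auto
  consider "X = [0]" | m where "X = [0, 1] @ replicate m 0" | "X = short_block a"
    | c where "X = long_block a c" "X \<in> long_blocks a b"
    using X by (auto simp: roots_eq long_blocks_def)
  then have Q: "all_prefixes ?Q n k (letter_weight n k (hd X)) (tl X)"
  proof cases
    case 2
    have z: "int i * int k \<le> int m * int k - int k" if "i < m" for i
      using ik[of "Suc i" m] that by (simp add: algebra_simps)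
    from P show ?thesis unfolding 2 using k z by (fastforce simp: algebra_simps)
  next
    case 3
    have z: "int i * int k \<le> int a * int k - int k" if "i < a" for i
      using ik[of "Suc i" a] that by (simp add: algebra_simps)
    from P have y: "y \<le> 0" "\<And>i. i < a \<Longrightarrow> 0 \<le> y + (int n - int k - int i * int k)"
      unfolding 3 by (auto simp: short_block_def)
    have "0 < y + 2 * (int n - int k - int i * int k)" if "i < a" for i
      using y(1) y(2)[OF that] z[OF that] nk H k by simp
    then show ?thesis unfolding 3 by (simp add: short_block_def)
  next
    case 4
    have "int ((a + 1) * k) < int n" using n'[OF 4(2)] by (simp only: of_nat_less_iff)
    then have Hpos: "0 < H" by (simp add: H_def algebra_simps)
    have c: "int j * H \<le> int c * H - H" "0 \<le> int j * H" if "j < c" for j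
      using mult_right_mono[of "int (Suc j)" "int c" H] that H by (simp_all add: algebra_simps)
    have z: "int i * int k \<le> int a * int k" if "i \<le> a" for i
      using ik[of i a] that by simp
    have z': "int i * int k \<le> int a * int k - int k" if "i < a" for i
      using ik[of "Suc i" a] that by (simp add: algebra_simps)
    have r: "(int a + 1) * int k = int a * int k + int k" by (simp add: algebra_simps)
    have y: "y \<le> 0"
      and y1: "\<And>i. i \<le> a \<Longrightarrow> 0 \<le> y + (int n - int k - int i * int k)"
      and y2: "\<And>j. j < c \<Longrightarrow> y + (H - int k + int c * H) + (H - int k + int j * H) \<le> 0"
      and y3: "\<And>j i. j < c \<Longrightarrow> i < a \<Longrightarrow>
        0 \<le> y + (H - int k + int j * H + int n - int k - int i * int k)"
      using P unfolding 4 all_prefixes_long_block(1)[OF nH] weight_long_block_H[OF nH]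
      by (simp_all add: add.assoc)
    have hd: "letter_weight n k (hd X) = int n - int k" by (simp add: 4 long_block_def)
    show ?thesis
      unfolding hd unfolding 4 all_prefixes_long_block(2)[OF nH]
    proof (intro conjI allI impI, goal_cases)
      case (1 i)
      then show ?case using y y1[of i] z[of i] nk Hpos by simp
    next
      case (2 j)
      then show ?case using y2[of j] c[of j] nk Hpos r by simp
    next
      case (3 j i)
      have "0 < H - int k + int j * H + int n - int k - int i * int k"
        using c[OF 3(1)] z'[OF 3(2)] nk Hpos by (smt (verit))
      then have "0 < y + 2 * (H - int k + int j * H + int n - int k - int i * int k)"
        using y3[OF 3] by (smt (verit))
      moreover have "int n - int k - (int a + 1) * int k = H - int k" by (simp add: nH)
      ultimately show ?case by simp
    qed
  qed auto
  obtain s' where s': "s = Suc s'" using s by (cases s) auto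
  obtain x u where xu: "X = x # u" using ne by (cases X) auto
  show ?thesis
    using Q s' s unfolding xu by (auto simp: all_prefixes_iff algebra_simps)
qed


subsection \<open>From solutions to bounded heights\<close>

text \<open>The interval has length \<open>n\<close>, so by \<open>height_cong_mod\<close> the
  position determines its height unless that is \<open>- int k\<close> or
  \<open>int n - int k\<close>.\<close>

definition window :: "nat \<Rightarrow> nat \<Rightarrow> (nat \<Rightarrow> bit) \<Rightarrow> bool" where
  "window n k V \<longleftrightarrow> (\<forall>t. - int k \<le> height n k V t \<and> height n k V t \<le> int n - int k)"

lemma window_lower: "window n k V \<Longrightarrow> - int k \<le> height n k V t"
  and window_upper: "window n k V \<Longrightarrow> height n k V t \<le> int n - int k"
  by (simp_all add: window_def)

text \<open>The next height must not leave the window either; hence the sign of a nonzero height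
  determines the letter.\<close>

lemma window_one: "window n k V \<Longrightarrow> V t = 1 \<Longrightarrow> height n k V t \<le> 0"
  using window_upper[of n k V "Suc t"] by (simp add: height_Suc)

lemma window_zero: "window n k V \<Longrightarrow> V t = 0 \<Longrightarrow> 0 \<le> height n k V t"
  using window_lower[of n k V "Suc t"] by (simp add: height_Suc)

lemma bit_one_or_zero: "(x :: bit) = 0 \<or> x = 1"
  by (cases x) auto

text \<open>Heights in the window are below \<open>n\<close> in absolute value, so the only one
  divisible by \<open>n\<close> is 0, and divisibility can be tested on
  \<open>k * t\<close>.\<close>

lemma height_multiple:
  assumes win: "window n k V" and k: "0 < k" "k < n"
  shows "height n k V t = 0 \<longleftrightarrow> n dvd k * t"
proof -
  have "n dvd k * t \<longleftrightarrow> int n dvd int k * int t"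
    by (metis of_nat_dvd_iff of_nat_mult)
  also have "\<dots> \<longleftrightarrow> int n dvd height n k V t"
    using height_cong_mod[of n k V t] by (metis dvd_add_left_iff dvd_add_right_iff)
  also have "\<dots> \<longleftrightarrow> height n k V t = 0"
  proof
    assume dvd: "int n dvd height n k V t"
    have "\<bar>height n k V t\<bar> < int n"
      using window_lower[OF win, of t] window_upper[OF win, of t] k by linarith
    with dvd show "height n k V t = 0" by (meson dvd_imp_le_int not_less zdvd_not_zless
        zero_less_abs_iff dvd_abs_iff)
  qed simp
  finally show ?thesis by simp
qed

text \<open>The sign of a nonzero height fixes the next letter, and height 0 occurs only where
  agreement is assumed; so the two words never separate.\<close>

lemma window_unique:
  assumes "window n k V" "window n k V'" "0 < k" "k < n"
    and eq: "\<And>t. n dvd k * t \<Longrightarrow> V t = V' t"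
  shows "V t = V' t"
proof -
  have "height n k V t = height n k V' t \<and> V t = V' t"
  proof (induction t rule: less_induct)
    case (less t)
    have h: "height n k V t = height n k V' t"
      using less by (cases t) (auto simp: height_Suc)
    have "V t = V' t"
    proof (cases "height n k V t = 0")
      case True
      then show ?thesis using height_multiple[OF assms(1,3,4)] eq by blast
    next
      case False
      then show ?thesis
        using window_one[OF assms(1), of t] window_one[OF assms(2), of t]
          window_zero[OF assms(1), of t] window_zero[OF assms(2), of t] h
          bit_one_or_zero[of "V t"] bit_one_or_zero[of "V' t"] by force
    qed
    with h show ?case by simp
  qed
  then show ?thesis by simp
qed

text \<open>For \<open>t = 2 * p\<close> with doubled height, the expression is twice the height
  reached from \<open>p\<close> through \<open>s\<close> letters of \<open>X\<close>. Its strict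
  sign excludes height 0 inside a root and, conversely, fixes the letter there.\<close>

lemma occurs_square_strict:
  assumes win: "window n k V" and X: "X \<in> roots a b" and a: "1 \<le> a" and k: "0 < k"
    and n: "(a + 1) * k \<le> n" and n': "X \<in> long_blocks a b \<Longrightarrow> (a + 1) * k < n"
    and occ: "occurs V t (X @ X)" and s: "0 < s" "s < length X"
  shows "if X ! s = 1 then height n k V t + 2 * weight n k (take s X) < 0
         else 0 < height n k V t + 2 * weight n k (take s X)"
proof (rule root_square_strict[OF X a k n n' _ s])
  fix r assume r: "r < length X"
  have o1: "occurs V t X" and o2: "occurs V (t + length X) X" using occ by simp_all
  have h: "height n k V (t + r) = height n k V t + weight n k (take r X)"
    "height n k V (t + length X + r) = height n k V t + weight n k X + weight n k (take r X)"
    using height_occurs_take[OF o1] height_occurs_take[OF o2] height_occurs[OF o1] r by simp_all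
  have l: "V (t + r) = X ! r" "V (t + length X + r) = X ! r"
    using o1 o2 r unfolding occurs_def by auto
  show "if X ! r = 1
       then height n k V t + weight n k (take r X) \<le> 0 \<and>
         height n k V t + weight n k X + weight n k (take r X) \<le> 0
       else 0 \<le> height n k V t + weight n k (take r X) \<and>
         0 \<le> height n k V t + weight n k X + weight n k (take r X)"
    using window_one[OF win, of "t + r"] window_one[OF win, of "t + length X + r"]
      window_zero[OF win, of "t + r"] window_zero[OF win, of "t + length X + r"]
      bit_one_or_zero[of "X ! r"] unfolding h l by auto
qed

text \<open>The square root map replaces each \<open>X @ X\<close> by \<open>X\<close>, so a
  breakpoint \<open>2 * p\<close> of \<open>w w\<close> becomes the breakpoint \<open>p\<close> of
  \<open>w\<close>, with half the prefix length and half the height.\<close>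

definition sqrt_step ::
    "nat \<Rightarrow> nat \<Rightarrow> nat \<Rightarrow> nat \<Rightarrow> (nat \<Rightarrow> bit) \<Rightarrow> nat \<Rightarrow> word01 \<Rightarrow> bool" where
  "sqrt_step n k a b V p X \<longleftrightarrow> X \<in> roots a b \<and> occurs V p X \<and> occurs V (2 * p) (X @ X) \<and>
     height n k V (2 * p) = 2 * height n k V p"

text \<open>If \<open>t\<close> lies in the root \<open>X\<close> starting at \<open>p\<close>, then the two copies of \<open>X\<close> in the square
  give \<open>height (p + t) = height p + height t\<close>, and the same for the end of \<open>X\<close> in place of
  \<open>p\<close>. Hence an extreme height is attained inside a root whose two endpoints have the opposite
  sign, and then it is bounded by the heights of single letters.\<close>

lemma sqrt_window:
  assumes per: "\<And>t. V (t + n) = V t" "height n k V n = 0"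
    and a: "1 \<le> a" and k: "0 < k" and n: "(a + 1) * k \<le> n"
    and steps: "\<And>t. t < n \<Longrightarrow> \<exists>p X. sqrt_step n k a b V p X \<and> p \<le> t \<and> t < p + length X"
  shows "window n k V"
proof -
  let ?f = "height n k V"
  have n0: "0 < n" using k n a by (metis add_is_0 gr0I le_zero_eq mult_is_0 not_one_le_zero)
  have fmod: "?f (t mod n) = ?f t" for t by (rule height_mod) (use per in auto)
  have step: "\<exists>p q w W. (w \<le> int n - int k \<or> w \<le> W + int n - int k) \<and> (- int k \<le> w \<or> W - int k \<le> w)
      \<and> ?f t = ?f p + w \<and> ?f q = ?f p + W \<and> ?f (p + t) = ?f p + ?f t \<and> ?f (q + t) = ?f q + ?f t"
    if t: "t < n" for t
  proof -
    obtain p X where X: "X \<in> roots a b" "occurs V p X" "occurs V (2 * p) X"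
      "occurs V (2 * p + length X) X" "?f (2 * p) = 2 * ?f p" and pt: "p \<le> t" "t < p + length X"
      using steps[OF t] by (auto simp: sqrt_step_def)
    define s where "s = t - p"
    define w where "w = weight n k (take s X)"
    define W where "W = weight n k X"
    have s: "t = p + s" "s < length X" using pt by (auto simp: s_def)
    have ft: "?f t = ?f p + w"
      using height_occurs_take[OF X(2), of s n k] s by (simp add: w_def)
    have fq: "?f (p + length X) = ?f p + W"
      using height_occurs[OF X(2), of n k] by (simp add: W_def)
    have shift: "p + t = 2 * p + s" "p + length X + t = 2 * p + length X + s" using s(1) by simp_all
    have "?f (p + t) = 2 * ?f p + w"
      using height_occurs_take[OF X(3), of s n k] s(2) unfolding shift X(5) w_def by simp
    moreover have "?f (p + length X + t) = 2 * ?f p + W + w"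
      using height_occurs_take[OF X(4), of s n k] height_occurs[OF X(3), of n k] s(2)
      unfolding shift X(5) w_def W_def by simp
    moreover have "(w \<le> int n - int k \<or> w \<le> W + int n - int k) \<and> (- int k \<le> w \<or> W - int k \<le> w)"
      using root_height_bounds[OF X(1) a n] s(2) unfolding all_prefixes_iff w_def W_def by simp
    ultimately show ?thesis using ft fq
      by (intro exI[of _ p] exI[of _ "p + length X"] exI[of _ w] exI[of _ W]) simp
  qed
  have fin: "finite (?f ` {..<n})" "?f ` {..<n} \<noteq> {}" using n0 by auto
  have upper: "?f u \<le> int n - int k" for u
  proof -
    obtain t where t: "t < n" "?f t = Max (?f ` {..<n})" using Max_in[OF fin] by auto
    have max: "?f u \<le> ?f t" for u
    proof -
      have "?f (u mod n) \<in> ?f ` {..<n}" using n0 by auto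
      then show ?thesis using Max_ge[OF fin(1)] t(2) fmod[of u] by metis
    qed
    obtain p q w W where *: "w \<le> int n - int k \<or> w \<le> W + int n - int k"
      "?f t = ?f p + w" "?f q = ?f p + W" "?f (p + t) = ?f p + ?f t" "?f (q + t) = ?f q + ?f t"
      using step[OF t(1)] by blast
    have "?f p \<le> 0" "?f q \<le> 0" using max[of "p + t"] max[of "q + t"] * by linarith+
    then have "?f t \<le> int n - int k" using * by linarith
    then show ?thesis using max[of u] by linarith
  qed
  have lower: "- int k \<le> ?f u" for u
  proof -
    obtain t where t: "t < n" "?f t = Min (?f ` {..<n})" using Min_in[OF fin] by auto
    have min: "?f t \<le> ?f u" for u
    proof -
      have "?f (u mod n) \<in> ?f ` {..<n}" using n0 by auto
      then show ?thesis using Min_le[OF fin(1)] t(2) fmod[of u] by metis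
    qed
    obtain p q w W where *: "- int k \<le> w \<or> W - int k \<le> w"
      "?f t = ?f p + w" "?f q = ?f p + W" "?f (p + t) = ?f p + ?f t" "?f (q + t) = ?f q + ?f t"
      using step[OF t(1)] by blast
    have "0 \<le> ?f p" "0 \<le> ?f q" using min[of "p + t"] min[of "q + t"] * by linarith+
    then have "- int k \<le> ?f t" using * by linarith
    then show ?thesis using min[of u] by linarith
  qed
  show ?thesis using upper lower by (simp add: window_def)
qed

lemma square_product_simps [simp]:
  "square_product [] = []"
  "square_product (X # Xs) = X @ X @ square_product Xs"
  "square_product (Xs @ Ys) = square_product Xs @ square_product Ys"
  by (simp_all add: square_product_def numeral_2_eq_2)

lemma length_square_product: "length (square_product Xs) = 2 * length (concat Xs)"
  by (induction Xs) auto

lemma weight_square_product: "weight n k (square_product Xs) = 2 * weight n k (concat Xs)"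
  by (induction Xs) auto

lemma concat_position:
  assumes "t < length (concat Xs)"
  shows "\<exists>Ys X Zs. Xs = Ys @ X # Zs \<and> length (concat Ys) \<le> t \<and>
    t < length (concat Ys) + length X"
  using assms
proof (induction Xs arbitrary: t)
  case (Cons X Xs)
  show ?case
  proof (cases "t < length X")
    case True
    then show ?thesis by (intro exI[of _ "[]"] exI[of _ X] exI[of _ Xs]) simp
  next
    case False
    then have "t - length X < length (concat Xs)" using Cons.prems by simp
    then obtain Ys Y Zs where "Xs = Ys @ Y # Zs" "length (concat Ys) \<le> t - length X"
      "t - length X < length (concat Ys) + length Y" using Cons.IH by blast
    then show ?thesis using False
      by (intro exI[of _ "X # Ys"] exI[of _ Y] exI[of _ Zs]) auto
  qed
qed simp

lemma square_product_sqrt_steps: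
  assumes "set Xs \<subseteq> roots a b" "occurs V 0 (concat Xs)" "occurs V 0 (square_product Xs)"
    "t < length (concat Xs)"
  shows "\<exists>p X. sqrt_step n k a b V p X \<and> p \<le> t \<and> t < p + length X"
proof -
  obtain Ys X Zs where Xs: "Xs = Ys @ X # Zs" and t: "length (concat Ys) \<le> t"
    "t < length (concat Ys) + length X"
    using concat_position[OF assms(4)] by blast
  have "height n k V (length (concat Ys)) = weight n k (concat Ys)"
    using height_occurs[of V 0 "concat Ys" n k] assms(2) Xs by simp
  moreover have "height n k V (2 * length (concat Ys)) = 2 * weight n k (concat Ys)"
    using height_occurs[of V 0 "square_product Ys" n k] assms(3) Xs
    by (simp add: length_square_product weight_square_product)
  ultimately show ?thesis using assms(1-3) Xs t
    by (intro exI[of _ "length (concat Ys)"] exI[of _ X])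
       (auto simp: sqrt_step_def length_square_product)
qed

subsection \<open>Pattern words\<close>

text \<open>With \<open>g = gcd n k\<close> and \<open>d = n div g\<close>, this is the \<open>n\<close>-periodic word whose \<open>i\<close>-th block
  of length \<open>d\<close> is the reversed standard word \<open>01u\<close> with \<open>k div g\<close> ones if \<open>i \<notin> A\<close> and
  \<open>10u\<close> if \<open>i \<in> A\<close>.\<close>

definition pattern_letter :: "nat \<Rightarrow> nat \<Rightarrow> nat set \<Rightarrow> nat \<Rightarrow> bit" where
  "pattern_letter n k A t =
    (let r = k * t mod n; i = t div (n div gcd n k) mod gcd n k in
     if r = 0 then of_bool (i \<in> A) else if r = k then of_bool (i \<notin> A) else of_bool (r < k))"

lemma dvd_mult_iff_period:
  fixes n k t :: nat
  assumes "0 < n"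
  shows "n dvd k * t \<longleftrightarrow> n div gcd n k dvd t"
proof -
  define g where "g = gcd n k"
  have g: "g > 0" "g dvd n" "g dvd k" using assms by (auto simp: g_def)
  have cop: "coprime (n div g) (k div g)"
    using assms unfolding g_def by (intro div_gcd_coprime) auto
  have "n dvd k * t \<longleftrightarrow> g * (n div g) dvd g * ((k div g) * t)"
    using g by (simp add: mult.assoc[symmetric])
  also have "\<dots> \<longleftrightarrow> n div g dvd (k div g) * t" using g(1) by (rule nat_mult_dvd_cancel1)
  also have "\<dots> \<longleftrightarrow> n div g dvd t" using cop by (simp add: coprime_dvd_mult_right_iff)
  finally show ?thesis by (simp add: g_def)
qed

lemma gcd_period_pos: "0 < n \<Longrightarrow> 0 < n div gcd n (k :: nat)"
  by (simp add: div_greater_zero_iff dvd_imp_le)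

lemma pattern_letter_periodic:
  assumes "0 < n"
  shows "pattern_letter n k A (t + n) = pattern_letter n k A t"
proof -
  define g where "g = gcd n k"
  have g: "g > 0" "g dvd n" using assms by (auto simp: g_def)
  have d: "n div g > 0" using gcd_period_pos[OF assms] by (simp add: g_def)
  have "(t + g * (n div g)) div (n div g) = t div (n div g) + g"
    using d by simp
  moreover have "g * (n div g) = n" using g by simp
  ultimately have "(t + n) div (n div g) = t div (n div g) + g" by argo
  moreover have "k * (t + n) mod n = k * t mod n" by (simp add: distrib_left)
  ultimately show ?thesis by (simp add: pattern_letter_def g_def[symmetric] Let_def)
qed

lemma pattern_letter_multiple:
  assumes "0 < n"
  shows "pattern_letter n k A (i * (n div gcd n k)) = of_bool (i mod gcd n k \<in> A)"
proof -
  have "n div gcd n k > 0" using assms by (rule gcd_period_pos)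
  moreover have "k * (i * (n div gcd n k)) mod n = 0"
    using dvd_mult_iff_period[OF assms, of k "i * (n div gcd n k)"] by auto
  ultimately show ?thesis by (simp add: pattern_letter_def Let_def)
qed

text \<open>The height is congruent to \<open>- r t\<close> modulo \<open>n\<close>, so the window
  leaves one value unless \<open>r t = k\<close>. That residue follows residue 0, where the letter
  chosen by \<open>A\<close> leads to \<open>- k\<close> or to \<open>n - k\<close>; the
  complementary letter makes both choices meet again at \<open>n - 2 * k\<close>.\<close>

lemma pattern_height:
  assumes k: "0 < k" "2 * k \<le> n"
  defines "r \<equiv> \<lambda>t. k * t mod n"
  shows "height n k (pattern_letter n k A) t =
    (if r t < k then - int (r t)
     else if r t = k \<and> t div (n div gcd n k) mod gcd n k \<notin> A then - int k
     else int n - int (r t))"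
proof (induction t)
  case 0
  then show ?case using k by (simp add: r_def)
next
  case (Suc t)
  define i where "i = (\<lambda>t. t div (n div gcd n k) mod gcd n k)"
  have r: "r t < n" using k by (simp add: r_def)
  have rS: "r (Suc t) = (if r t + k < n then r t + k else r t + k - n)"
  proof -
    have "r (Suc t) = (r t + k) mod n" by (simp add: r_def mod_simps algebra_simps)
    then show ?thesis using r k by (simp add: mod_if)
  qed
  \<comment> \<open>The block index is looked up again at residue \<open>k\<close>. As the block
    length exceeds 1, the position after a multiple of it is still in the same block.\<close>
  have i_eq: "i (Suc t) = i t" if "r t = 0"
  proof -
    have "n div gcd n k dvd t"
      using that k dvd_mult_iff_period[of n k t] by (simp add: r_def mod_eq_0_iff_dvd)
    moreover have "n div gcd n k \<noteq> 1"
    proof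
      assume "n div gcd n k = 1"
      then have "n = gcd n k" using k by (metis dvd_mult_div_cancel gcd_dvd1 mult.right_neutral)
      then have "n \<le> k" using k(1) by (metis gcd_le2_nat neq0_conv)
      then show False using k by simp
    qed
    ultimately have "\<not> n div gcd n k dvd Suc t"
      using dvd_diff_nat[of "n div gcd n k" "Suc t" t] by auto
    then show ?thesis by (simp add: i_def div_Suc mod_eq_0_iff_dvd)
  qed
  have p: "pattern_letter n k A t = (if r t = 0 then of_bool (i t \<in> A)
      else if r t = k then of_bool (i t \<notin> A) else of_bool (r t < k))"
    by (simp add: pattern_letter_def r_def i_def Let_def)
  have IH: "height n k (pattern_letter n k A) t =
    (if r t < k then - int (r t) else if r t = k \<and> i t \<notin> A then - int k else int n - int (r t))"
    using Suc by (simp add: i_def)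
  have "height n k (pattern_letter n k A) (Suc t) =
    (if r (Suc t) < k then - int (r (Suc t)) else if r (Suc t) = k \<and> i (Suc t) \<notin> A then - int k
     else int n - int (r (Suc t)))"
  proof (cases "r t = 0")
    case True
    then show ?thesis using rS i_eq[OF True] k p IH
      by (cases "i t \<in> A") (simp_all add: height_Suc)
  next
    case False
    consider "r t < k" | "r t = k" | "r t > k" by linarith
    then show ?thesis
    proof cases
      case 1
      then show ?thesis using False rS k p IH by (simp add: height_Suc)
    next
      case 2
      then show ?thesis using False rS k p IH
        by (cases "i t \<in> A") (auto simp: height_Suc)
    next
      case 3
      then show ?thesis using False rS k p IH r by (auto simp: height_Suc)
    qed
  qed
  then show ?case by (simp add: i_def)
qed

lemma pattern_window:
  assumes "0 < k" "2 * k \<le> n"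
  shows "window n k (pattern_letter n k A)"
proof -
  have "int (k * t mod n) < int n" for t using assms by simp
  then have "- int k \<le> int n - int (k * t mod n)" for t by (smt (verit) of_nat_0_le_iff)
  then show ?thesis
    unfolding window_def pattern_height[OF assms] using assms by (auto simp: not_less)
qed

lemma pattern_height_period:
  assumes "0 < k" "2 * k \<le> n"
  shows "height n k (pattern_letter n k A) n = 0"
  using assms by (simp add: pattern_height)

subsection \<open>Counting ones in windows\<close>

definition in_lang :: "(nat \<Rightarrow> bit) \<Rightarrow> nat \<Rightarrow> nat \<Rightarrow> nat \<Rightarrow> bool" where
  "in_lang V m a b \<longleftrightarrow>
     (\<exists>s i. sset s \<subseteq> long_blocks a b \<and> (\<forall>t<m. V t = flat s !! (i + t)))"

lemma in_lang_iff: "map V [0..<m] \<in> lang a b \<longleftrightarrow> in_lang V m a b"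
proof -
  have "map V [0..<m] = stake m (sdrop i s) \<longleftrightarrow> (\<forall>t<m. V t = s !! (i + t))" for i s
    unfolding list_eq_iff_nth_eq by (simp add: sdrop_snth)
  then show ?thesis
    unfolding lang_def in_lang_def S56_eq long_blocks_def by simp
qed

text \<open>Reduced modulo \<open>n\<close>, the occurrence starts at \<open>n - 1\<close> at the
  latest, so \<open>n + 1\<close> letters still end within the first \<open>2 * n\<close>.\<close>

lemma in_lang_occurs:
  assumes n: "0 < n" and per: "\<And>t. V (t + n) = V t" and L: "in_lang V (2 * n) a b"
    and occ: "occurs V t u" and len: "length u \<le> n + 1"
  obtains s t' where "sset s \<subseteq> long_blocks a b" "occurs (snth (flat s)) t' u"
proof -
  obtain s i where s: "sset s \<subseteq> long_blocks a b" and eq: "\<And>t. t < 2 * n \<Longrightarrow> V t = flat s !! (i + t)"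
    using L unfolding in_lang_def by blast
  have "flat s !! (i + t mod n + j) = u ! j" if "j < length u" for j
  proof -
    have "V (t mod n + j) = V (t + j)"
      by (metis periodic_mod[of V n, OF per] mod_add_left_eq)
    moreover have "t mod n < n" using n by simp
    then have "t mod n + j < 2 * n" using that len by linarith
    ultimately show ?thesis using eq[of "t mod n + j"] occ that by (simp add: occurs_def add.assoc)
  qed
  then show ?thesis using that[OF s, of "i + t mod n"] by (simp add: occurs_def)
qed


lemma sum_periodic_shift:
  fixes f :: "nat \<Rightarrow> nat"
  assumes "\<And>t. f (t + n) = f t"
  shows "(\<Sum>t<n. f (t + j)) = (\<Sum>t<n. f t)"
proof (induction j)
  case (Suc j)
  have "(\<Sum>t<n. f (t + Suc j)) + f j = (\<Sum>t<Suc n. f (t + j))"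
    by (subst sum.lessThan_Suc_shift) simp
  also have "\<dots> = (\<Sum>t<n. f (t + j)) + f j" using assms[of j] by (simp add: add.commute)
  finally show ?case using Suc by simp
qed simp

lemma count_list_map_upt: "count_list (map V [0..<n]) x = (\<Sum>t<n. of_bool (V t = x))"
  by (induction n) auto

text \<open>Double counting: each of the \<open>n\<close> cyclic windows of \<open>a + 1\<close>
  letters holds at most one one, and each one lies in \<open>a + 1\<close> windows. An empty window
  makes the count strict.\<close>

lemma ones_sparse:
  assumes n: "0 < n" and per: "\<And>t. V (t + n) = V t" and k: "count_list (map V [0..<n]) 1 = k"
    and far: "\<And>t j. V t = 1 \<Longrightarrow> 1 \<le> j \<Longrightarrow> j \<le> a \<Longrightarrow> V (t + j) = (0 :: bit)"
  shows "(a + 1) * k \<le> n"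
    and "(\<And>j. j \<le> a \<Longrightarrow> V (u + j) = 0) \<Longrightarrow> (a + 1) * k < n"
proof -
  define f :: "nat \<Rightarrow> nat" where "f t = of_bool (V t = 1)" for t
  have "(\<Sum>t<n. \<Sum>j\<le>a. f (t + j)) = (\<Sum>j\<le>a. \<Sum>t<n. f (t + j))" by (rule sum.swap)
  also have "\<dots> = (\<Sum>j\<le>a. k)"
    using sum_periodic_shift[of f n] per k by (simp add: f_def count_list_map_upt)
  finally have total: "(\<Sum>t<n. \<Sum>j\<le>a. f (t + j)) = (a + 1) * k" by simp
  have le1: "(\<Sum>j\<le>a. f (t + j)) \<le> 1" for t
  proof -
    have far': "\<not> i < j" if "i \<le> a" "j \<le> a" "V (t + i) = 1" "V (t + j) = 1" for i j
    proof
      assume "i < j"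
      then have "1 \<le> j - i" "j - i \<le> a" "t + i + (j - i) = t + j" using that by simp_all
      then show False using far[OF that(3), of "j - i"] that(4) by simp
    qed
    have "(\<Sum>j\<le>a. f (t + j)) = card {j. j \<le> a \<and> V (t + j) = 1}"
      by (simp add: f_def sum.inter_filter[symmetric] Collect_conj_eq Int_commute atMost_def)
    also have "\<dots> \<le> 1"
      using far' by (subst card_le_Suc0_iff_eq[simplified One_nat_def[symmetric]])
        (auto, meson linorder_neqE_nat)
    finally show ?thesis .
  qed
  have "(\<Sum>t<n. \<Sum>j\<le>a. f (t + j)) \<le> (\<Sum>t<n. 1)" by (intro sum_mono le1)
  then show "(a + 1) * k \<le> n" unfolding total by simp
  assume z: "\<And>j. j \<le> a \<Longrightarrow> V (u + j) = 0"
  have "V (u mod n + j) = V (u + j)" for j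
    by (metis periodic_mod[of V n, OF per] mod_add_left_eq)
  then have "(\<Sum>j\<le>a. f (u mod n + j)) = 0" using z by (simp add: f_def)
  then have "(\<Sum>t<n. \<Sum>j\<le>a. f (t + j)) < (\<Sum>t<n. 1)"
    using n le1 by (intro sum_strict_mono_ex1) (auto intro!: bexI[of _ "u mod n"])
  then show "(a + 1) * k < n" unfolding total by simp
qed

lemma in_lang_zeros_after_one:
  assumes n: "0 < n" and per: "\<And>t. V (t + n) = V t" and L: "in_lang V (2 * n) a b"
    and one: "V t = 1" and j: "1 \<le> j" "j \<le> a"
  shows "V (t + j) = 0"
proof -
  obtain s i where s: "sset s \<subseteq> long_blocks a b" and eq: "\<And>t. t < 2 * n \<Longrightarrow> V t = flat s !! (i + t)"
    using L unfolding in_lang_def by blast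
  define t' where "t' = t mod n"
  have t': "t' < n" "V t' = 1" using n one periodic_mod[of V n, OF per] by (auto simp: t'_def)
  have shift: "V (t' + j) = V (t + j)" for j
    unfolding t'_def by (metis periodic_mod[of V n, OF per] mod_add_left_eq)
  have far: "flat s !! (i + t' + j) = 0" if "1 \<le> j" "j \<le> a" for j
    using flat_zeros_after_one[OF s _ that, of "i + t'"] t' eq[of t'] by simp
  \<comment> \<open>A one recurs after \<open>n\<close> letters. The bound also keeps
    \<open>t' + j\<close> below \<open>2 * n\<close>.\<close>
  have "\<not> n \<le> a"
  proof
    assume "n \<le> a"
    then have "V (t' + n) = 0" using far[of n] eq[of "t' + n"] t'(1) n by (simp add: add.assoc)
    then show False using per[of t'] t'(2) by simp
  qed
  then show ?thesis
    using far[OF j] eq[of "t' + j"] t'(1) j shift[of j] by (simp add: add.assoc)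
qed

text \<open>These are the unions of doubling orbits other than that of 0;
  \<open>0 \<notin> A\<close> makes the word begin with 0.\<close>

definition pattern_sets :: "nat \<Rightarrow> nat set set" where
  "pattern_sets g = {A. A \<subseteq> {0..<g} \<and> 0 \<notin> A \<and> (\<forall>i<g. 2 * i mod g \<in> A \<longleftrightarrow> i \<in> A)}"

text \<open>\<open>sqrt_window\<close> confines the heights, every position of height 0 turns out to
  be a breakpoint, and \<open>window_unique\<close> recovers the word from its letters at these
  positions.\<close>

theorem solution_is_pattern:
  assumes a: "1 \<le> a" and sol: "is_solution a b w" and hd: "hd w = 0" and k: "0 < count_list w 1"
  defines "n \<equiv> length w" and "k \<equiv> count_list w 1"
  obtains A where "2 * k \<le> n" "A \<in> pattern_sets (gcd n k)"
    "w = map (pattern_letter n k A) [0..<n]" "in_lang (pattern_letter n k A) (2 * n) a b"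
proof -
  define V where "V t = w ! (t mod n)" for t
  obtain Xs where w: "w \<noteq> []" and lang: "w @ w \<in> lang a b" and Xs: "set Xs \<subseteq> roots a b"
    "w = concat Xs" "square_product Xs = w @ w"
    using sol by (auto simp: is_solution_def Pi_words_def numeral_2_eq_2)
  have n0: "0 < n" and k0: "0 < k" using w k by (simp_all add: n_def k_def)
  have per: "V (t + n) = V t" for t by (simp add: V_def)
  have Vw: "map V [0..<n] = w"
    unfolding list_eq_iff_nth_eq by (simp add: V_def n_def)
  have occ_w: "occurs V 0 w" using occurs_map[of V 0 n] Vw by simp
  have occ_ww: "occurs V 0 (w @ w)" 
    using w by (auto simp: occurs_def V_def n_def nth_append le_mod_geq)
  then have Vww: "map V [0..<2 * n] = w @ w" by (simp add: occurs_iff_map n_def mult_2)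
  have L: "in_lang V (2 * n) a b" using lang unfolding Vww[symmetric] in_lang_iff .
  have kV: "count_list (map V [0..<n]) 1 = k" by (simp add: Vw k_def)
  have hn: "height n k V n = 0"
    using kV by (simp add: height_def weight_count)
  have far: "V (t + j) = 0" if "V t = 1" "1 \<le> j" "j \<le> a" for t j
    using in_lang_zeros_after_one[OF n0 per L that] .
  have ak: "(a + 1) * k \<le> n" by (rule ones_sparse(1)[OF n0 per kV far])
  have "2 * k \<le> (a + 1) * k" using a by (intro mult_right_mono) auto
  then have k2: "2 * k \<le> n" using ak by (rule order_trans)
  then have kn: "k < n" using k0 by simp
  have steps: "\<exists>p X. sqrt_step n k a b V p X \<and> p \<le> t \<and> t < p + length X" if "t < n" for t
    using square_product_sqrt_steps[OF Xs(1)] occ_w occ_ww that Xs(2,3) by (simp add: n_def)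
  have win: "window n k V" by (rule sqrt_window[OF per hn a k0 ak steps])
  \<comment> \<open>Strictly inside a root, twice the height would be nonzero by
    \<open>occurs_square_strict\<close>. So \<open>t\<close> is a breakpoint, and \<open>X\<close>
    begins at both \<open>t\<close> and \<open>2 * t\<close>.\<close>
  have double: "V (2 * t) = V t" if dvd_t: "n dvd k * t" and t: "t < n" for t
  proof -
    have h0: "height n k V t = 0" using height_multiple[OF win k0 kn] dvd_t by simp
    obtain p X where X: "X \<in> roots a b" "occurs V p X" "occurs V (2 * p) (X @ X)"
      "height n k V (2 * p) = 2 * height n k V p" and pt: "p \<le> t" "t < p + length X"
      using steps[OF t] by (auto simp: sqrt_step_def)
    show ?thesis
    proof (cases "p = t")
      case True
      then show ?thesis using X(2,3) pt by (cases X) auto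
    next
      case False
      define s where "s = t - p"
      have s: "0 < s" "s < length X" "t = p + s" using pt False by (auto simp: s_def)
      \<comment> \<open>The \<open>a + 1\<close> zeros of a long block form an empty window for
        \<open>ones_sparse\<close>.\<close>
      have ak': "(a + 1) * k < n" if long: "X \<in> long_blocks a b"
      proof -
        have zeros: "occurs V (2 * p + 1) (replicate (a + 1) 0)"
          using X(3) long by (auto simp: long_blocks_def long_block_def)
        have "V (2 * p + 1 + j) = 0" if "j \<le> a" for j
          using zeros that unfolding occurs_replicate by simp
        then show ?thesis
          using ones_sparse(2)[of n V k a "2 * p + 1", OF n0 per kV far] by blast
      qed
      have "height n k V (2 * p) + 2 * weight n k (take s X) = 2 * height n k V t"
        using height_occurs_take[OF X(2), of s n k] s X(4) by simp
      then show ?thesis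
        using occurs_square_strict[OF win X(1) a k0 ak ak' X(3) s(1,2)] h0
        by (simp split: if_splits)
    qed
  qed
  define g where "g = gcd n k"
  define d where "d = n div g"
  have g: "0 < g" "g * d = n" and d: "0 < d"
    using n0 gcd_period_pos[OF n0] by (auto simp: g_def d_def)
  have dvd: "n dvd k * t \<longleftrightarrow> d dvd t" for t
    using dvd_mult_iff_period[OF n0] by (simp add: g_def d_def)
  define A where "A = {i. i < g \<and> V (i * d) = 1}"
  have Vd: "V (i * d) = of_bool (i mod g \<in> A)" for i
  proof -
    have "i * d mod n = (i mod g) * d" using g(2) by (metis mult_mod_left mult.commute)
    then have "V (i * d) = V (i mod g * d)" using periodic_mod[of V n "i * d", OF per] by simp
    then show ?thesis using g(1) bit_one_or_zero[of "V (i mod g * d)"] by (auto simp: A_def)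
  qed
  have V: "V t = pattern_letter n k A t" for t
  proof (rule window_unique[OF win pattern_window[OF k0 k2] k0 kn])
    fix t assume "n dvd k * t"
    then obtain i where "t = i * d" unfolding dvd by (metis dvdE mult.commute)
    then show "V t = pattern_letter n k A t"
      using Vd[of i] pattern_letter_multiple[OF n0, of k A i] by (simp add: g_def d_def)
  qed
  have "2 * i mod g \<in> A \<longleftrightarrow> i \<in> A" if i: "i < g" for i
  proof -
    have "i * d < n" using i d unfolding g(2)[symmetric] by simp
    then have "V (2 * (i * d)) = V (i * d)" using double[of "i * d"] dvd by simp
    then have "of_bool (2 * i mod g \<in> A) = (of_bool (i mod g \<in> A) :: bit)"
      using Vd[of "2 * i"] Vd[of i] by (simp add: mult.assoc)
    then show ?thesis using i by (auto split: if_splits)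
  qed
  moreover have "0 \<notin> A" using hd w by (auto simp: A_def V_def hd_conv_nth)
  ultimately have "A \<in> pattern_sets (gcd n k)" by (auto simp: pattern_sets_def A_def g_def)
  moreover have "V = pattern_letter n k A" using V by blast
  ultimately show ?thesis using that[of A] k2 Vw L by simp
qed

subsection \<open>Pattern words are solutions\<close>

text \<open>Induction on the part of the word not yet factored. A square found at
  \<open>2 * p\<close> is halved: its root is shown to occur at \<open>p\<close>, and the next
  breakpoint again satisfies the doubling relation between heights.\<close>

lemma pattern_square_roots:
  assumes k: "0 < k" "2 * k \<le> n" and A: "A \<in> pattern_sets (gcd n k)" and a: "1 \<le> a"
    and ak: "(a + 1) * k < n"
  defines "V \<equiv> pattern_letter n k A"
  assumes roots: "\<And>t. \<exists>X\<in>roots a b. occurs V t (X @ X)"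
    and p: "p \<le> n" "height n k V (2 * p) = 2 * height n k V p"
  shows "\<exists>Xs. set Xs \<subseteq> roots a b \<and> concat Xs = map V [p..<n] \<and>
    square_product Xs = map V [2 * p..<2 * n]"
  using p
proof (induction "n - p" arbitrary: p rule: less_induct)
  case less
  have n0: "0 < n" using k by simp
  have win: "window n k V" unfolding V_def by (rule pattern_window[OF k])
  have ak': "(a + 1) * k \<le> n" using ak by simp
  show ?case
  proof (cases "p = n")
    case True
    then show ?thesis by (intro exI[of _ "[]"]) simp
  next
    case False
    obtain X where X: "X \<in> roots a b" and occ: "occurs V (2 * p) (X @ X)"
      using roots by blast
    have len: "0 < length X" using X by (auto simp: roots_eq short_block_def long_block_def)
    have strict: "if X ! s = 1 then height n k V p + weight n k (take s X) < 0
        else 0 < height n k V p + weight n k (take s X)" if "0 < s" "s < length X" for s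
      using occurs_square_strict[OF win X a k(1) ak' ak occ that] less.prems(2)
      by (simp split: if_splits)
    \<comment> \<open>At height 0 the position is a multiple of the block length, and
      \<open>A\<close> is invariant under doubling; otherwise the heights at \<open>p\<close> and
      \<open>2 * p\<close> have the same sign.\<close>
    have "V p = V (2 * p)"
    proof (cases "height n k V p = 0")
      case True
      then have "n dvd k * p" using height_multiple[OF win k(1)] k by simp
      then obtain i where i: "p = i * (n div gcd n k)"
        unfolding dvd_mult_iff_period[OF n0] by (metis dvdE mult.commute)
      have "2 * (i mod gcd n k) mod gcd n k \<in> A \<longleftrightarrow> i mod gcd n k \<in> A"
        using A k by (auto simp: pattern_sets_def)
      then have "2 * i mod gcd n k \<in> A \<longleftrightarrow> i mod gcd n k \<in> A" by (simp add: mod_mult_right_eq)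
      then show ?thesis
        using pattern_letter_multiple[OF n0, of k A i] pattern_letter_multiple[OF n0, of k A "2 * i"]
        unfolding i V_def by (simp add: mult.assoc)
    next
      case False
      then show ?thesis
        using window_one[OF win, of p] window_one[OF win, of "2 * p"]
          window_zero[OF win, of p] window_zero[OF win, of "2 * p"] less.prems(2)
          bit_one_or_zero[of "V p"] bit_one_or_zero[of "V (2 * p)"] by force
    qed
    moreover have "V (2 * p) = X ! 0" using occ len by (cases X) auto
    ultimately have first: "V p = X ! 0" by simp
    \<comment> \<open>Once \<open>s\<close> letters agree, the height at \<open>p + s\<close> is
      known, and its strict sign forces the letter \<open>X ! s\<close>.\<close>
    have occ_p: "occurs V p (take s X)" if "s \<le> length X" for s
      using that
    proof (induction s)
      case (Suc s)
      then have IH: "occurs V p (take s X)" and s: "s < length X" by simp_all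
      have "V (p + s) = X ! s"
      proof (cases "s = 0")
        case True
        then show ?thesis using first by simp
      next
        case False
        have "height n k V (p + s) = height n k V p + weight n k (take s X)"
          using height_occurs[OF IH, of n k] s by simp
        then show ?thesis
          using strict[of s] False s window_one[OF win, of "p + s"] window_zero[OF win, of "p + s"]
            bit_one_or_zero[of "V (p + s)"] bit_one_or_zero[of "X ! s"]
          by (auto split: if_splits)
      qed
      then show ?case using IH s by (simp add: take_Suc_conv_app_nth)
    qed simp
    then have occX: "occurs V p X" by (metis order_refl take_all)
    \<comment> \<open>A root cannot straddle \<open>n\<close>, because the height is 0 there and
      nonzero at inner positions of a root.\<close>
    have le: "p + length X \<le> n"
    proof (rule ccontr)
      assume gt: "\<not> p + length X \<le> n"
      define s where "s = n - p"
      have s: "0 < s" "s < length X" "n = p + s" using gt False less.prems(1) by (auto simp: s_def)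
      have "height n k V (p + s) \<noteq> 0"
        using strict[OF s(1,2)] height_occurs_take[OF occX, of s n k] s(2) by (simp split: if_splits)
      then show False using pattern_height_period[OF k, of A] s(3) by (simp add: V_def)
    qed
    let ?q = "p + length X"
    have "height n k V (2 * ?q) = 2 * height n k V ?q"
      using height_occurs[OF occX, of n k] height_occurs[OF occ, of n k] less.prems(2)
      by (simp add: algebra_simps)
    moreover have "n - ?q < n - p" using le len by linarith
    ultimately obtain Xs where Xs: "set Xs \<subseteq> roots a b" "concat Xs = map V [?q..<n]"
      "square_product Xs = map V [2 * ?q..<2 * n]"
      using less.hyps[of ?q] le by blast
    have split: "map V [i..<m] = u @ map V [i + length u..<m]"
      if "occurs V i u" "i + length u \<le> m" for i m u
    proof -
      have "[i..<m] = [i..<i + length u] @ [i + length u..<m]"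
        using upt_add_eq_append[of i "i + length u" "m - (i + length u)"] that(2) by simp
      then show ?thesis using that(1) by (simp add: occurs_iff_map)
    qed
    have "concat (X # Xs) = map V [p..<n]" using split[OF occX le] Xs(2) by simp
    moreover have "square_product (X # Xs) = map V [2 * p..<2 * n]"
      using split[OF occ, of "2 * n"] Xs(3) le by (simp add: algebra_simps)
    ultimately show ?thesis using X Xs(1) by (intro exI[of _ "X # Xs"]) auto
  qed
qed

theorem pattern_is_solution:
  assumes k: "0 < k" "2 * k \<le> n" and A: "A \<in> pattern_sets (gcd n k)" and a: "1 \<le> a"
    and ak: "(a + 1) * k < n" and s: "sset s \<subseteq> long_blocks a b"
    and V: "\<And>t. pattern_letter n k A t = flat s !! (i + t)"
  shows "is_solution a b (map (pattern_letter n k A) [0..<n])"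
proof -
  let ?V = "pattern_letter n k A"
  have n0: "0 < n" using k by simp
  have "\<exists>X\<in>roots a b. occurs ?V t (X @ X)" for t
    using flat_root_square[OF s a, of "i + t"] by (auto simp: occurs_def V add.assoc)
  then obtain Xs where Xs: "set Xs \<subseteq> roots a b" "concat Xs = map ?V [0..<n]"
    "square_product Xs = map ?V [0..<2 * n]"
    using pattern_square_roots[OF k A a ak, of b 0] by auto
  have double: "map ?V [0..<2 * n] = map ?V [0..<n] @ map ?V [0..<n]"
    unfolding list_eq_iff_nth_eq
    using pattern_letter_periodic[OF n0, of k A]
    by (auto simp: nth_append) (metis le_add_diff_inverse2 not_less)
  have "map ?V [0..<2 * n] \<in> lang a b"
    unfolding in_lang_iff in_lang_def using s V by blast
  then show ?thesis using Xs n0 double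
    by (auto simp: is_solution_def Pi_words_def numeral_2_eq_2)
qed

subsection \<open>Runs of zeros\<close>

text \<open>The invariant \<open>P\<close> allows a block to be chosen at every position reached;
  iterating the jump to its end produces the stream.\<close>

lemma flat_from_steps:
  fixes V :: "nat \<Rightarrow> bit"
  assumes P: "P t0"
    and step: "\<And>t. P t \<Longrightarrow> \<exists>X\<in>B. X \<noteq> [] \<and> occurs V t X \<and> P (t + length X)"
  shows "\<exists>s. sset s \<subseteq> B \<and> (\<forall>m. V (t0 + m) = flat s !! m)"
proof -
  obtain X where X: "\<And>t. P t \<Longrightarrow> X t \<in> B \<and> X t \<noteq> [] \<and> occurs V t (X t) \<and> P (t + length (X t))"
    using step by metis
  define f where "f t = t + length (X t)" for t
  define s where "s t = smap X (siterate f t)" for t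
  have s: "s t = X t ## s (f t)" for t by (subst s_def, subst siterate.code) (simp add: s_def)
  have Pf: "P ((f ^^ m) t0)" for m
    by (induction m) (use P X in \<open>auto simp: f_def\<close>)
  have "sset (s t0) \<subseteq> B"
    using Pf X by (auto simp: s_def stream.set_map sset_siterate)
  moreover have "V (t + m) = flat (s t) !! m" if "P t" for t m
    using that
  proof (induction m arbitrary: t rule: less_induct)
    case (less m)
    have flat: "flat (s t) = X t @- flat (s (f t))"
      using X[OF less.prems] by (subst s) (rule flat_Stream, simp)
    show ?case
    proof (cases "m < length (X t)")
      case True
      then show ?thesis using X[OF less.prems] unfolding flat by (simp add: occurs_def)
    next
      case False
      have "0 < length (X t)" using X[OF less.prems] by simp
      then have "m - length (X t) < m" using False by linarith
      moreover have "P (f t)" using X[OF less.prems] by (simp add: f_def)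
      ultimately have "V (f t + (m - length (X t))) = flat (s (f t)) !! (m - length (X t))"
        using less.IH by blast
      then show ?thesis using False unfolding flat by (simp add: f_def)
    qed
  qed
  ultimately show ?thesis using P by blast
qed

lemma short_block_snoc: "short_block a @ [0] = 1 # replicate (a + 1) 0"
  by (simp add: short_block_def replicate_append_same)

text \<open>After the one the height is at least \<open>n - 2 * k\<close>, which is
  \<open>(a - 1) * k + R\<close>. So it is positive before each of the next \<open>a\<close>
  letters, and the whole block weighs \<open>R\<close>.\<close>

lemma short_run:
  assumes win: "window n k V" and n: "n = (a + 1) * k + R" and R: "0 < R" and one: "V t = 1"
  shows "occurs V t (short_block a)" "height n k V (t + (a + 1)) = height n k V t + int R"
proof -
  have nk: "int n - int k = int a * int k + int R" using n by (simp add: algebra_simps)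
  have zero: "V (Suc t + i) = 0"
    if i: "i < a" "height n k V (Suc t + i) = height n k V t + int n - int k - int i * int k" for i
  proof -
    have "int (Suc i) * int k \<le> int a * int k" using i(1) by (intro mult_right_mono) auto
    then have "int i * int k \<le> int a * int k - int k" by (simp add: algebra_simps)
    then have "0 < height n k V (Suc t + i)"
      using i(2) window_lower[OF win, of t] nk R by linarith
    then show ?thesis
      using window_one[OF win, of "Suc t + i"] bit_one_or_zero[of "V (Suc t + i)"] by auto
  qed
  have h: "height n k V (Suc t + i) = height n k V t + int n - int k - int i * int k" if "i \<le> a" for i
    using that
  proof (induction i)
    case 0
    then show ?case using one by (simp add: height_Suc)
  next
    case (Suc i)
    then show ?case using zero[of i] by (simp add: height_Suc algebra_simps)
  qed
  show occ: "occurs V t (short_block a)"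
    using one h zero by (simp add: short_block_def occurs_replicate)
  show "height n k V (t + (a + 1)) = height n k V t + int R"
    using height_occurs[OF occ, of n k] nk by (simp add: algebra_simps)
qed

lemma short_runs:
  assumes win: "window n k V" and n: "n = (a + 1) * k + R" and R: "0 < R"
    and neg: "\<And>j. j < m \<Longrightarrow> height n k V t + int j * int R < 0"
  shows "occurs V t (concat (replicate m (short_block a)))"
  using neg
proof (induction m)
  case (Suc m)
  then have IH: "occurs V t (concat (replicate m (short_block a)))" by simp
  have w: "weight n k (short_block a) = int R" using n by (simp add: algebra_simps)
  have "height n k V (t + m * (a + 1)) = height n k V t + int m * int R"
    using height_occurs[OF IH, of n k] w by simp
  then have "V (t + m * (a + 1)) = 1"
    using Suc.prems[of m] window_zero[OF win] bit_one_or_zero by (metis lessI not_le)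
  then have "occurs V (t + m * (a + 1)) (short_block a)" by (rule short_run(1)[OF win n R])
  then show ?case using IH by (simp only: concat_replicate_Suc_right occurs_append)
      simp
qed simp

text \<open>Each short block raises the height by \<open>R\<close>, and heights before ones are at
  most 0, so the short blocks must stop; they stop at an extra zero.\<close>

lemma next_long_run:
  assumes win: "window n k V" and n: "n = (a + 1) * k + R" and R: "0 < R"
    and one: "V t = 1"
  shows "\<exists>j. occurs V t (concat (replicate j (short_block a)) @ 1 # replicate (a + 1) 0)"
  using one
proof (induction "nat (- height n k V t)" arbitrary: t rule: less_induct)
  case less
  note run = short_run[OF win n R less.prems]
  show ?case
  proof (cases "V (t + (a + 1)) = 0")
    case True
    then have "occurs V t (short_block a @ [0])" using run(1) by simp
    then show ?thesis
      unfolding short_block_snoc by (intro exI[of _ 0]) simp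
  next
    case False
    then have one': "V (t + (a + 1)) = 1" using bit_one_or_zero by blast
    then have "height n k V (t + (a + 1)) \<le> 0" by (rule window_one[OF win])
    then have "nat (- height n k V (t + (a + 1))) < nat (- height n k V t)" using run(2) R by simp
    then obtain j where
      "occurs V (t + (a + 1)) (concat (replicate j (short_block a)) @ 1 # replicate (a + 1) 0)"
      using less.hyps one' by blast
    then show ?thesis using run(1) by (intro exI[of _ "Suc j"]) simp
  qed
qed

text \<open>The number \<open>j\<close> of short runs satisfies \<open>j * R \<le> k < (j + 2) * R\<close>; equality on the right
  would require \<open>R dvd k\<close> and a one at a position of height \<open>0\<close>, which \<open>amb\<close> excludes.\<close>

lemma next_long_run_bounds:
  assumes win: "window n k V" and n: "n = (a + 1) * k + R" and R: "0 < R" "R \<le> k"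
    and amb: "(\<forall>t. V t = 1 \<longrightarrow> height n k V t < 0) \<or> \<not> R dvd k"
    and t: "V t = 1" "height n k V t \<le> int R - int k"
      "(\<forall>t. V t = 1 \<longrightarrow> height n k V t < 0) \<Longrightarrow> height n k V t < int R - int k"
  shows "\<exists>j. (j = k div R - 1 \<or> j = k div R) \<and>
    occurs V t (concat (replicate j (short_block a)) @ 1 # replicate (a + 1) 0)"
proof -
  obtain j where occ: "occurs V t (concat (replicate j (short_block a)) @ 1 # replicate (a + 1) 0)"
    using next_long_run[OF win n R(1) t(1)] by blast
  define u where "u = t + j * (a + 1)"
  have w: "weight n k (short_block a) = int R" using n by (simp add: algebra_simps)
  have hu: "height n k V u = height n k V t + int j * int R"
    using occ height_occurs[of V t "concat (replicate j (short_block a))" n k] w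
    by (simp add: u_def)
  have occ_u: "occurs V u (1 # replicate (a + 1) 0)" using occ by (simp add: u_def)
  have V_u: "V u = 1" "V (u + (a + 1)) = 0"
    using occ_u unfolding occurs_Cons occurs_replicate by auto
  have h2: "0 \<le> height n k V u + int R"
    using window_zero[OF win V_u(2)] short_run(2)[OF win n R(1) V_u(1)] by simp
  have "int (j * R) \<le> int k"
    using hu window_one[OF win V_u(1)] window_lower[OF win, of t] by simp
  then have jk: "j * R \<le> k" by (simp only: of_nat_le_iff)
  then have le: "j \<le> k div R" using R by (simp add: less_eq_div_iff_mult_less_eq)
  have "k < (j + 2) * R"
  proof (cases "\<forall>t. V t = 1 \<longrightarrow> height n k V t < 0")
    case True
    then have "int k < int ((j + 2) * R)" using t(3) hu h2 by (simp add: algebra_simps)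
    then show ?thesis by (simp only: of_nat_less_iff)
  next
    case False
    then have "\<not> R dvd k" using amb by blast
    have "int k \<le> int ((j + 2) * R)" using t(2) hu h2 by (simp add: algebra_simps)
    then have "k \<le> (j + 2) * R" by (simp only: of_nat_le_iff)
    then show ?thesis using \<open>\<not> R dvd k\<close> by (metis dvd_triv_right le_neq_implies_less)
  qed
  then have "k div R < j + 2" by (simp add: less_mult_imp_div_less)
  then have "j = k div R - 1 \<or> j = k div R" using le by linarith
  then show ?thesis using occ by blast
qed

text \<open>The word is cut at its long runs, and \<open>next_long_run_bounds\<close> counts the
  short blocks between consecutive cuts. The piece before the first cut is a suffix of a long
  block.\<close>

lemma window_in_flat:
  assumes win: "window n k V" and V0: "V 0 = 0" and k: "0 < k" and a: "1 \<le> a"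
    and n: "n = (a + 1) * k + R" and R: "0 < R" "R \<le> k"
    and amb: "(\<forall>t. V t = 1 \<longrightarrow> height n k V t < 0) \<or> \<not> R dvd k"
  shows "\<exists>s i. sset s \<subseteq> long_blocks a (k div R - 1) \<and> (\<forall>t. V t = flat s !! (i + t))"
proof -
  define b where "b = k div R - 1"
  have "0 < k div R" using R by (simp add: div_greater_zero_iff)
  then have b: "k div R = b + 1" by (simp add: b_def)
  define P where "P t \<longleftrightarrow> occurs V t (1 # replicate (a + 1) 0)" for t
  have reach: "\<exists>j. (j = b \<or> j = b + 1) \<and> occurs V t (concat (replicate j (short_block a))) \<and>
      P (t + j * (a + 1))"
    if t: "V t = 1" "height n k V t \<le> int R - int k"
      "(\<forall>t. V t = 1 \<longrightarrow> height n k V t < 0) \<Longrightarrow> height n k V t < int R - int k" for t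
    using next_long_run_bounds[OF win n R amb t] unfolding b by (auto simp: P_def)
  have "V 1 = 1"
    using window_zero[OF win, of 1] height_Suc[of n k V 0] V0 k bit_one_or_zero[of "V 1"] by auto
  then obtain j0 where j0: "j0 = b \<or> j0 = b + 1"
    "occurs V 1 (concat (replicate j0 (short_block a)))" "P (1 + j0 * (a + 1))"
    using reach[of 1] height_Suc[of n k V 0] V0 R by auto
  have step: "\<exists>X\<in>long_blocks a b. X \<noteq> [] \<and> occurs V u X \<and> P (u + length X)" if "P u" for u
  proof -
    have occ: "occurs V u (1 # replicate (a + 1) 0)" using that by (simp add: P_def)
    then have one: "V u = 1" by simp
    define t where "t = u + (a + 2)"
    have h: "height n k V t = height n k V u + int R - int k"
      using height_occurs[OF occ, of n k] n by (simp add: t_def algebra_simps)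
    have le: "height n k V u \<le> 0" by (rule window_one[OF win one])
    \<comment> \<open>The change \<open>R - k\<close> is at most 0. Height 0 at \<open>t\<close>
      would need \<open>R = k\<close> and a one at height 0, contrary to both alternatives of
      \<open>amb\<close>.\<close>
    have "height n k V t < 0"
    proof (rule ccontr)
      assume "\<not> height n k V t < 0"
      then have "R = k" "height n k V u = 0" using h le R(2) by linarith+
      then show False using amb one by auto
    qed
    then have "V t = 1" using window_zero[OF win, of t] bit_one_or_zero[of "V t"] by auto
    then obtain j where "j = b \<or> j = b + 1" "occurs V t (concat (replicate j (short_block a)))"
      "P (t + j * (a + 1))"
      using reach[of t] h le one by auto
    then show ?thesis using occ
      by (intro bexI[of _ "long_block a j"])
        (auto simp: long_blocks_def long_block_def t_def algebra_simps)
  qed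
  obtain s where s: "sset s \<subseteq> long_blocks a b" "\<And>m. V (1 + j0 * (a + 1) + m) = flat s !! m"
    using flat_from_steps[of P "1 + j0 * (a + 1)", OF j0(3) step] by blast
  \<comment> \<open>The zero in front is the last one of the long run if \<open>j0 = b + 1\<close>,
    and the last one of the first short block if \<open>j0 = b\<close>, where
    \<open>a \<ge> 1\<close> provides it.\<close>
  have "\<exists>Q. long_block a (b + 1) = Q @ 0 # concat (replicate j0 (short_block a))"
    using j0(1)
  proof
    assume "j0 = b + 1"
    then show ?thesis
      by (intro exI[of _ "1 # replicate a 0"])
         (simp add: long_block_def replicate_app_Cons_same del: concat.simps)
  next
    assume "j0 = b"
    moreover obtain a' where "a = Suc a'" using a by (cases a) auto
    ultimately show ?thesis
      by (intro exI[of _ "1 # replicate (a + 1) 0 @ 1 # replicate a' 0"])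
         (simp add: long_block_def short_block_def replicate_app_Cons_same)
  qed
  then obtain Q where Q: "long_block a (b + 1) = Q @ 0 # concat (replicate j0 (short_block a))"
    by blast
  define u where "u = 0 # concat (replicate j0 (short_block a))"
  have len: "length u = 1 + j0 * (a + 1)" by (simp add: u_def)
  have flat: "flat (long_block a (b + 1) ## s) = (Q @ u) @- flat s"
    unfolding Q u_def[symmetric] by (rule flat_Stream) (simp add: u_def)
  have "V t = flat (long_block a (b + 1) ## s) !! (length Q + t)" for t
  proof (cases "t < length u")
    case True
    have "occurs V 0 u" using V0 j0(2) by (simp add: u_def)
    then have "V t = u ! t" using True by (simp add: occurs_def)
    then show ?thesis unfolding flat using True by simp
  next
    case False
    have "flat (long_block a (b + 1) ## s) !! (length Q + t) = flat s !! (t - length u)"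
      unfolding flat using False by simp
    also have "\<dots> = V (length u + (t - length u))" using s(2) unfolding len by simp
    finally show ?thesis using False by simp
  qed
  moreover have "sset (long_block a (b + 1) ## s) \<subseteq> long_blocks a b"
    using s(1) by (simp add: long_blocks_def)
  ultimately show ?thesis unfolding b_def[symmetric] by blast
qed

subsection \<open>Excluded patterns\<close>

lemma in_lang_one_in_window:
  assumes n: "0 < n" and per: "\<And>t. V (t + n) = V t" and L: "in_lang V (2 * n) a b"
    and one: "V u = 1"
  shows "\<exists>j\<le>a + 1. V (t + j) = 1"
proof -
  obtain s i where s: "sset s \<subseteq> long_blocks a b" and eq: "\<And>t. t < 2 * n \<Longrightarrow> V t = flat s !! (i + t)"
    using L unfolding in_lang_def by blast
  have an: "a < n"
    using in_lang_zeros_after_one[OF n per L one, of n] per[of u] one n by force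
  obtain j where j: "j \<le> a + 1" "flat s !! (i + t mod n + j) = 1"
    using flat_one_in_window[OF s] by blast
  have "t mod n < n" using n by simp
  then have "t mod n + j < 2 * n" using j(1) an by linarith
  then have "V (t mod n + j) = 1" using eq j(2) by (simp add: add.assoc)
  moreover have "V (t mod n + j) = V (t + j)"
    by (metis periodic_mod[of V n, OF per] mod_add_left_eq)
  ultimately show ?thesis using j(1) by auto
qed

lemma nat_change_point:
  assumes "P x" "\<not> P y" "x \<le> (y :: nat)"
  obtains i where "P i" "\<not> P (Suc i)"
  using assms(3,1,2) by (metis dec_induct)

text \<open>With \<open>d = c * q + 1\<close>, a passage from \<open>A\<close> to its complement is
  compared with one back. For \<open>c \<ge> 2\<close> they show long runs separated by
  \<open>c - 2\<close> and by \<open>c\<close> short blocks, while a language allows only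
  \<open>b\<close> and \<open>b + 1\<close>. For \<open>c = 1\<close> a run of \<open>q + 1\<close>
  zeros and ones at distance \<open>q\<close> exclude each other.\<close>

theorem pattern_not_in_lang:
  assumes k: "0 < k" "2 * k \<le> n" and A: "A \<in> pattern_sets (gcd n k)" "A \<noteq> {}"
    and dvd: "k div gcd n k dvd n div gcd n k - 1"
    and L: "in_lang (pattern_letter n k A) (2 * n) a b"
  shows False
proof -
  define V where "V = pattern_letter n k A"
  define g where "g = gcd n k"
  define d where "d = n div g"
  define c where "c = k div g"
  have n0: "0 < n" and kn: "k < n" using k by simp_all
  have g: "0 < g" "n = g * d" "k = g * c" using k by (auto simp: g_def d_def c_def)
  have c0: "0 < c" using k g by (cases c) auto
  have d0: "0 < d" using n0 g(2) by (cases d) auto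
  obtain q where "d - 1 = c * q" using dvd unfolding c_def d_def g_def by (rule dvdE)
  then have d: "d = c * q + 1" using d0 by simp
  have nq: "n = q * k + g" using g d by (simp add: algebra_simps)
  have q0: "0 < q" 
  proof (rule ccontr)
    assume "\<not> 0 < q"
    then have "n = g" using nq by simp
    moreover have "g \<le> k" using g(3) c0 by simp
    ultimately show False using kn by simp
  qed
  have win: "window n k V" unfolding V_def by (rule pattern_window[OF k])
  have per: "V (t + n) = V t" for t unfolding V_def by (rule pattern_letter_periodic[OF n0])
  have L': "in_lang V (2 * n) a b" using L by (simp add: V_def)
  have run_n: "n = (q - 1 + 1) * k + g" using nq q0 by simp
  have Vd: "V (i * d) = of_bool (i mod g \<in> A)" for i
    using pattern_letter_multiple[OF n0] by (simp add: V_def d_def g_def)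
  have h0: "height n k V (i * d) = 0" for i
    using height_multiple[OF win k(1) kn] g by (simp add: algebra_simps)
  obtain m where m: "m \<in> A" "m < g" "0 \<notin> A"
    using A by (force simp: pattern_sets_def g_def)
  have g2: "2 \<le> g" using m by (cases "m = 0") auto
  obtain i1 where i1: "i1 mod g \<in> A" "Suc i1 mod g \<notin> A"
    using nat_change_point[of "\<lambda>i. i mod g \<in> A" m g] m by auto
  obtain i2 where i2: "i2 mod g \<notin> A" "Suc i2 mod g \<in> A"
    using nat_change_point[of "\<lambda>i. i mod g \<notin> A" 0 m] m by auto
  \<comment> \<open>The shift by one period leaves room to the left of \<open>t2\<close> for the
    long run that ends there.\<close>
  have i2': "(i2 + g) mod g \<notin> A" "Suc (i2 + g) mod g \<in> A"
    using i2 by (metis mod_add_self2, metis add_Suc mod_add_self2)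
  define t1 where "t1 = i1 * d"
  define t2 where "t2 = (i2 + g) * d"
  have t1: "V t1 = 1" "V (t1 + d) = 0" "height n k V t1 = 0"
    using Vd[of i1] Vd[of "Suc i1"] h0[of i1] i1 by (simp_all add: t1_def add.commute)
  have t2: "V t2 = 0" "V (t2 + d) = 1" "height n k V t2 = 0" "height n k V (t2 + d) = 0"
    using Vd[of "i2 + g"] Vd[of "Suc (i2 + g)"] h0[of "i2 + g"] h0[of "Suc (i2 + g)"] i2'
    by (simp_all add: t2_def add.commute[of _ d])
  have neg: "V t = 1" if "height n k V t < 0" for t
    using window_zero[OF win, of t] that bit_one_or_zero[of "V t"] by auto
  have pos: "V t = 0" if "0 < height n k V t" for t
    using window_one[OF win, of t] that bit_one_or_zero[of "V t"] by auto
  \<comment> \<open>\<open>short_run\<close> gives \<open>q - 1\<close> zeros and reaches height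
    \<open>g > 0\<close>, which forces one zero more.\<close>
  have long: "occurs V t (1 # replicate q 0)" if "V t = 1" "height n k V t = 0" for t
  proof -
    note run = short_run[OF win run_n g(1) that(1)]
    have "V (t + q) = 0" by (rule pos) (use run(2) that(2) g(1) q0 in simp)
    then have "occurs V t (short_block (q - 1) @ [0])" using run(1) q0 by simp
    moreover have "short_block (q - 1) @ [0] = 1 # replicate q 0"
      using short_block_snoc[of "q - 1"] q0 by simp
    ultimately show ?thesis by metis
  qed
  have long1: "occurs V t1 (1 # replicate q 0)" by (rule long) (rule t1)+
  have long2: "occurs V (t2 + d) (1 # replicate q 0)" by (rule long) (rule t2)+
  have h1: "height n k V (t1 + (q + 1)) = int g - int k"
    using height_occurs[OF long1, of n k] t1(3) nq by (simp add: algebra_simps)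
  have h2: "height n k V (t2 + 1) = - int k" using t2 by (simp add: height_Suc)
  have one2: "V (t2 + 1) = 1" by (rule neg) (use h2 k in simp)
  have far: "\<not> (1 \<le> j \<and> j \<le> a)" if "V t = 1" "V (t + j) = 1" for t j
    using in_lang_zeros_after_one[OF n0 per L' that(1)] that(2) by auto
  have zeros1: "V (t1 + 1 + j) = 0" if "j < q" for j
    using long1 that unfolding occurs_Cons occurs_replicate by simp
  have near: "\<exists>j\<le>a + 1. V (t1 + 1 + j) = 1" by (rule in_lang_one_in_window[OF n0 per L' t1(1)])
  show False
  proof (cases "c = 1")
    case True
    have dq: "d = q + 1" using d True by simp
    have "V (t1 + 1 + j) = 0" if "j \<le> q" for j
      using zeros1[of j] t1(2) that dq by (cases "j = q") auto
    then have "q < a + 1" using near by (metis leI le_trans zero_neq_one)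
    moreover have "V (t2 + 1 + q) = 1" using t2(2) dq by (simp add: algebra_simps)
    ultimately show False using far[OF one2, of q] q0 by simp
  next
    case False
    then obtain c' where c': "c = Suc (Suc c')" using c0 by (metis One_nat_def not0_implies_Suc less_not_refl)
    have "q \<le> a + 1" using near zeros1 by (metis leI le_trans zero_neq_one)
    have kc: "int k = int c * int g" using g(3) by simp
    \<comment> \<open>The height is \<open>- (c - 1) * g\<close> at the start and grows by
      \<open>g\<close> per block, so \<open>c - 1\<close> blocks fit before height 0; from
      \<open>t2 + 1\<close>, at height \<open>- k\<close>, there are \<open>c\<close>.\<close>
    have runs1: "occurs V (t1 + (q + 1)) (concat (replicate (Suc c') (short_block (q - 1))))"
    proof (rule short_runs[OF win run_n g(1)])
      fix j assume "j < Suc c'"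
      then have "int (Suc j) * int g < int c * int g"
        using g(1) c' by (intro mult_strict_right_mono) auto
      then show "height n k V (t1 + (q + 1)) + int j * int g < 0"
        unfolding h1 kc by (simp add: algebra_simps)
    qed
    have runs2: "occurs V (t2 + 1) (concat (replicate c (short_block (q - 1))))"
    proof (rule short_runs[OF win run_n g(1)])
      fix j assume "j < c"
      then have "int j * int g < int c * int g"
        using g(1) by (intro mult_strict_right_mono) auto
      then show "height n k V (t2 + 1) + int j * int g < 0" unfolding h2 kc by simp
    qed
    have "V (t2 + 1 + q) = 1"
      using runs2 q0 unfolding c' by (simp add: short_block_def)
    then have "\<not> q \<le> a" using far[OF one2, of q] q0 by simp
    \<comment> \<open>The parameter is now forced: the short blocks found above are those of the
      language, and \<open>flat_short_runs\<close> applies.\<close>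
    then have aq: "q = a + 1" using \<open>q \<le> a + 1\<close> by simp
    have end1: "t1 + (q + 1) + Suc c' * q = t1 + d" using d c' by (simp add: algebra_simps)
    have "V (t1 + (a + 1 + 1) + Suc c' * (a + 1)) = 0"
      using t1(2) end1 unfolding aq by metis
    then have "occurs V t1
        ((1 # replicate (a + 1) 0) @ concat (replicate (Suc c') (short_block a)) @ [0])"
      using long1 runs1 unfolding aq occurs_append by (simp add: add.commute add.left_commute)
    also have "(1 # replicate (a + 1) 0) @ concat (replicate (Suc c') (short_block a)) @ [0] =
        long_block a c' @ 1 # replicate (a + 1) 0"
      unfolding concat_replicate_Suc_right
      by (simp add: long_block_def short_block_def replicate_append_same)
    finally have occ1: "occurs V t1 (long_block a c' @ 1 # replicate (a + 1) 0)" .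
    have "length (long_block a c' @ 1 # replicate (a + 1) 0) = d + 1"
      using d c' aq by (simp add: algebra_simps)
    moreover have "d \<le> n" using g by simp
    ultimately have "c' = b \<or> c' = b + 1"
      using in_lang_occurs[OF n0 per L' occ1] flat_short_runs by (metis add_le_cancel_right)
    \<comment> \<open>The left long run ends at \<open>t2\<close>: by \<open>height_cong_mod\<close>
      the position \<open>t2 - q\<close> has height \<open>- g\<close>, so it carries a one, which
      is followed by \<open>q\<close> zeros.\<close>
    moreover have "c = b \<or> c = b + 1"
    proof -
      have gd: "2 * d \<le> n" using g2 g(2) by simp
      have "2 * q \<le> c * q" using c' by simp
      then have "2 * q + 1 \<le> d" using d by simp
      moreover have "1 * d \<le> t2" unfolding t2_def using g(1) by (intro mult_right_mono) auto
      ultimately have qt: "q \<le> t2" by simp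
      define r where "r = t2 - q"
      have t2r: "t2 = r + q" using qt by (simp add: r_def)
      have "int n dvd height n k V r + int k * int r" by (rule height_cong_mod)
      moreover have "int n dvd height n k V t2 + int k * int t2" by (rule height_cong_mod)
      ultimately have "int n dvd (height n k V r + int k * int r) - (height n k V t2 + int k * int t2) + int n"
        by (metis dvd_add dvd_diff dvd_refl)
      moreover have "(height n k V r + int k * int r) - (height n k V t2 + int k * int t2) + int n
          = height n k V r + int g"
        using t2(3) nq by (simp add: t2r algebra_simps)
      ultimately have div: "int n dvd height n k V r + int g" by simp
      have "1 * g < c * g" using c' g(1) by (intro mult_strict_right_mono) auto
      then have gk: "g < k" using g(3) by (simp add: mult.commute)
      have "\<bar>height n k V r + int g\<bar> < int n"
        using window_lower[OF win, of r] window_upper[OF win, of r] gk kn by linarith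
      then have hr: "height n k V r = - int g"
        using div by (metis abs_dvd_iff dvd_abs_iff eq_neg_iff_add_eq_0 zdvd_not_zless zero_less_abs_iff)
      have "V r = 1" by (rule neg) (use hr g in simp)
      then have "occurs V r (short_block a @ [0])"
        using short_run(1)[OF win run_n g(1)] t2(1) unfolding t2r aq by simp
      then have "occurs V r (1 # replicate (a + 1) 0)" unfolding short_block_snoc .
      moreover have "t2 + d = t2 + 1 + c * (a + 1)" using d aq by simp
      then have "occurs V (r + (a + 1) + 1 + c * (a + 1)) (1 # replicate (a + 1) 0)"
        using long2 unfolding t2r aq by metis
      moreover have "occurs V (r + (a + 1) + 1) (concat (replicate c (short_block a)))"
        using runs2 unfolding t2r aq by simp
      ultimately have "occurs V r ((1 # replicate (a + 1) 0) @ concat (replicate c (short_block a))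
          @ 1 # replicate (a + 1) 0)"
        unfolding occurs_append by simp
      then have "occurs V r (long_block a c @ 1 # replicate (a + 1) 0)"
        by (simp only: long_block_def append_Cons append_assoc)
      moreover have "length (long_block a c @ 1 # replicate (a + 1) 0) \<le> n + 1"
        using d aq gd \<open>2 * q + 1 \<le> d\<close> by (simp add: algebra_simps)
      ultimately show ?thesis
        using in_lang_occurs[OF n0 per L'] flat_short_runs by metis
    qed
    ultimately show False using c' by auto
  qed
qed

subsection \<open>The set of solutions\<close>

lemma in_lang_single_block:
  assumes "occurs V 0 u" "Q @ u \<in> long_blocks a b" "m \<le> length u"
  shows "in_lang V m a b"
proof -
  have ne: "Q @ u \<noteq> []" using assms(2) by (auto simp: long_blocks_def long_block_def)
  have "flat (sconst (Q @ u)) = (Q @ u) @- flat (sconst (Q @ u))"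
    using ne by (subst siterate.code) (simp add: flat_Stream del: shift_append)
  then have "V t = flat (sconst (Q @ u)) !! (length Q + t)" if "t < m" for t
    using that assms(1,3) by (metis add_diff_cancel_left' less_le_trans not_add_less1 occurs_def
        shift_append shift_snth_ge shift_snth_less add_0 le_add1)
  then show ?thesis using assms(2) unfolding in_lang_def
    by (intro exI[of _ "sconst (Q @ u)"] exI[of _ "length Q"]) (simp add: sset_sconst)
qed

lemma square_product_replicate: "square_product (replicate m X) = concat (replicate (2 * m) X)"
  by (induction m) auto

lemma is_solution_replicate:
  assumes "X \<in> roots a b" "0 < m" "X \<noteq> []" "concat (replicate (2 * m) X) \<in> lang a b"
  shows "is_solution a b (concat (replicate m X))"
proof -
  have double: "concat (replicate m X) @ concat (replicate m X) = concat (replicate (2 * m) X)"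
    by (simp add: mult_2 replicate_add)
  have roots: "set (replicate m X) \<subseteq> roots a b" using assms(1,2) by simp
  have pow2: "concat (replicate 2 u) = u @ u" for u :: word01 by (simp add: numeral_2_eq_2)
  show ?thesis
    unfolding is_solution_def Pi_words_def pow2 double mem_Collect_eq
    using assms(2-4) roots square_product_replicate[of m X] double
    by (intro conjI exI[of _ "replicate m X"]) auto
qed

text \<open>The word is a power of \<open>S1\<close>, and \<open>a = 2 * n\<close> makes the zeros
  of one long block outlast \<open>w w\<close>.\<close>

lemma zero_word_solution:
  assumes "0 < n"
  shows "is_solution (2 * n) 0 (replicate n 0)"
proof -
  have "in_lang (\<lambda>_. 0) (2 * n) (2 * n) 0"
    by (rule in_lang_single_block[where u = "replicate (2 * n + 1) 0" and Q = "[1]"])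
      (auto simp: occurs_replicate long_blocks_def long_block_def simp del: replicate.simps)
  then have "replicate (2 * n) 0 \<in> lang (2 * n) 0"
    by (simp add: in_lang_iff[symmetric] map_replicate_const)
  then show ?thesis
    using is_solution_replicate[of "[0]" "2 * n" 0 n] assms by (simp add: roots_eq)
qed

text \<open>For \<open>a = 1\<close> the root \<open>S2 a\<close> is \<open>01\<close>, and
  \<open>b = 2 * k\<close> makes the alternating tail of one long block contain
  \<open>w w\<close>.\<close>

lemma alternating_word_solution:
  assumes "0 < k"
  shows "is_solution 1 (2 * k) (map (\<lambda>t. of_bool (odd t)) [0..<2 * k])"
proof -
  let ?V = "\<lambda>t. of_bool (odd t) :: bit"
  have occ: "occurs ?V t (concat (replicate m [1, 0]))" if "odd t" for m t
    using that by (induction m arbitrary: t) auto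
  have alt: "map ?V [0..<2 * m] = concat (replicate m [0, 1])" for m
  proof (induction m)
    case (Suc m)
    then show ?case unfolding concat_replicate_Suc_right by simp
  qed simp
  have "in_lang ?V (4 * k) 1 (2 * k)"
    by (rule in_lang_single_block[where u = "0 # concat (replicate (2 * k) [1, 0])" and Q = "[1, 0]"])
      (use occ[of 1] in \<open>auto simp: long_blocks_def long_block_def short_block_def\<close>)
  then have "map ?V [0..<2 * (2 * k)] \<in> lang 1 (2 * k)" unfolding in_lang_iff by simp
  then have "concat (replicate (2 * k) [0, 1]) \<in> lang 1 (2 * k)" unfolding alt .
  then show ?thesis
    unfolding alt using assms by (intro is_solution_replicate) (auto simp: roots_eq)
qed

lemma is_solution_no_11:
  assumes "is_solution a b w" "1 \<le> a"
  shows "\<not> sublist [1, 1] w"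
proof
  assume "sublist [1, 1] w"
  then obtain xs ys where w: "w = xs @ [1, 1] @ ys" by (auto simp: sublist_def)
  have "w @ w \<in> lang a b" using assms(1) by (simp add: is_solution_def Pi_words_def numeral_2_eq_2)
  then obtain s i where s: "sset s \<subseteq> long_blocks a b"
    and eq: "w @ w = stake (length (w @ w)) (sdrop i (flat s))"
    unfolding lang_def S56_eq long_blocks_def by blast
  have nth: "(w @ w) ! t = flat s !! (i + t)" if "t < length (w @ w)" for t
    using that by (subst eq) (simp add: sdrop_snth)
  have "flat s !! (i + length xs) = 1" "flat s !! (i + length xs + 1) = 1"
    using nth[of "length xs"] nth[of "length xs + 1"] w by (simp_all add: nth_append)
  then show False
    using flat_zeros_after_one[OF s, of "i + length xs" 1] assms(2) by simp
qed

lemma generic_pattern_solution: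
  assumes k: "0 < k" "2 * k < n" and A: "A \<in> pattern_sets (gcd n k)"
    and adm: "A = {} \<or> \<not> k div gcd n k dvd n div gcd n k - 1"
  shows "\<exists>a b. 1 \<le> a \<and> is_solution a b (map (pattern_letter n k A) [0..<n])"
proof -
  let ?V = "pattern_letter n k A"
  define g where "g = gcd n k"
  \<comment> \<open>Dividing \<open>n - 1\<close> instead of \<open>n\<close> puts the remainder
    \<open>R\<close> into the range from 1 to \<open>k\<close>; \<open>2 * k < n\<close> yields
    \<open>m \<ge> 2\<close> and hence \<open>a \<ge> 1\<close>.\<close>
  define m where "m = (n - 1) div k"
  define a where "a = m - 1"
  define R where "R = n - m * k"
  have n0: "0 < n" and k2: "2 * k \<le> n" and kn: "k < n" using k by simp_all
  have g: "0 < g" "g dvd n" "g dvd k" using n0 by (simp_all add: g_def)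
  have "2 * k \<le> n - 1" using k by simp
  then have m2: "2 \<le> m" using k by (simp add: m_def less_eq_div_iff_mult_less_eq)
  then have a: "1 \<le> a" "m = a + 1" by (simp_all add: a_def)
  have div: "n - 1 = m * k + (n - 1) mod k" by (simp add: m_def)
  have "(n - 1) mod k < k" using k by simp
  then have R: "0 < R" "R \<le> k" and nR: "n = m * k + R"
    using div n0 unfolding R_def by linarith+
  have win: "window n k ?V" by (rule pattern_window[OF k(1) k2])
  have V0: "?V 0 = 0" using A by (simp add: pattern_letter_def pattern_sets_def)
  have amb: "(\<forall>t. ?V t = 1 \<longrightarrow> height n k ?V t < 0) \<or> \<not> R dvd k"
  proof (cases "A = {}")
    case True
    have "height n k ?V t < 0" if "?V t = 1" for t
    proof (rule ccontr)
      assume "\<not> height n k ?V t < 0"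
      then have "height n k ?V t = 0" using window_one[OF win that] by simp
      then have "n div gcd n k dvd t"
        using height_multiple[OF win k(1) kn] dvd_mult_iff_period[OF n0] by simp
      then obtain i where "t = i * (n div gcd n k)" by (metis dvdE mult.commute)
      then show False using pattern_letter_multiple[OF n0, of k A i] True that by simp
    qed
    then show ?thesis by blast
  next
    case False
    \<comment> \<open>If \<open>R\<close> divided \<open>k\<close>, it would divide \<open>n\<close>
      and so equal \<open>g\<close>; then \<open>n div g = m * (k div g) + 1\<close>, the case
      excluded by \<open>adm\<close>.\<close>
    have "\<not> R dvd k"
    proof
      assume Rk: "R dvd k"
      then have "R dvd n" using nR by simp
      then have "R dvd g" using Rk by (simp add: g_def)
      moreover have "g dvd R" using g nR by (metis dvd_add_right_iff dvd_mult)
      ultimately have "R = g" by (rule dvd_antisym)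
      then have "n div g = m * (k div g) + 1"
        using nR g by (metis div_mult_swap div_plus_div_distrib_dvd_left div_self dvd_mult not_less0)
      then show False using False adm by (simp add: g_def)
    qed
    then show ?thesis ..
  qed
  obtain s i where s: "sset s \<subseteq> long_blocks a (k div R - 1)" "\<And>t. ?V t = flat s !! (i + t)"
    using window_in_flat[OF win V0 k(1) a(1) _ R amb] nR a(2) by auto
  have "(a + 1) * k < n" using nR R a(2) by simp
  then have "is_solution a (k div R - 1) (map ?V [0..<n])"
    using pattern_is_solution[OF k(1) k2 A a(1) _ s] by blast
  then show ?thesis using a(1) by blast
qed

definition admissible_patterns :: "nat \<Rightarrow> nat \<Rightarrow> nat set set" where
  "admissible_patterns n k =
     {A \<in> pattern_sets (gcd n k). A = {} \<or> \<not> k div gcd n k dvd n div gcd n k - 1}"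

lemma empty_pattern [simp]: "{} \<in> pattern_sets g"
  by (simp add: pattern_sets_def)

text \<open>For \<open>k = 0\<close> the gcd is \<open>n\<close> and the divisibility reads
  \<open>0 dvd 0\<close>.\<close>

lemma admissible_patterns_0: "0 < n \<Longrightarrow> admissible_patterns n 0 = {{}}"
  by (auto simp: admissible_patterns_def)

lemma pattern_word_0: "map (pattern_letter n 0 {}) [0..<n] = replicate n 0"
  by (intro nth_equalityI) (simp_all add: pattern_letter_def)

lemma admissible_pattern_solution:
  assumes n: "0 < n" and k: "2 * k \<le> n" and A: "A \<in> admissible_patterns n k"
  shows "\<exists>a b. 1 \<le> a \<and> is_solution a b (map (pattern_letter n k A) [0..<n])"
proof -
  consider "k = 0" | "0 < k" "2 * k = n" | "0 < k" "2 * k < n" using k by linarith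
  then show ?thesis
  proof cases
    case 1
    then have "A = {}" using A admissible_patterns_0[OF n] by simp
    then show ?thesis
      using 1 zero_word_solution[OF n] n by (intro exI[of _ "2 * n"] exI[of _ 0]) (simp add: pattern_word_0)
  next
    case 2
    have gcd: "gcd n k = k" using 2 by (metis gcd.commute gcd_proj1_iff dvd_triv_right normalize_nat_def id_apply gcd_nat.absorb1)
    then have "A = {}" using A 2 by (auto simp: admissible_patterns_def)
    have "k * t mod n = k * (t mod 2)" for t
      using 2(2) mult_mod_right[of k t 2] by (simp add: mult.commute)
    then have "pattern_letter n k A t = of_bool (odd t)" for t
      using 2(1) by (cases "even t") (auto simp: pattern_letter_def Let_def \<open>A = {}\<close> mod_2_eq_odd)
    then have "map (pattern_letter n k A) [0..<n] = map (\<lambda>t. of_bool (odd t)) [0..<2 * k]"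
      using 2(2) by simp
    then show ?thesis using alternating_word_solution[OF 2(1)] by (metis order_refl)
  next
    case 3
    then show ?thesis using generic_pattern_solution A by (simp add: admissible_patterns_def)
  qed
qed

lemma pattern_word_count:
  assumes n: "0 < n" and k: "2 * k \<le> n" and A: "A \<in> admissible_patterns n k"
  shows "count_list (map (pattern_letter n k A) [0..<n]) 1 = k"
proof (cases "k = 0")
  case True
  then have "A = {}" using A admissible_patterns_0[OF n] by simp
  then show ?thesis using True by (simp add: pattern_word_0)
next
  case False
  then have "height n k (pattern_letter n k A) n = 0" using pattern_height_period k by simp
  then show ?thesis using n by (simp add: height_def weight_count)
qed

theorem solutions_eq_image:
  assumes n: "0 < n"
  shows "solutions_of_length n =
    (\<lambda>(k, A). map (pattern_letter n k A) [0..<n]) ` (SIGMA k:{k. 2 * k \<le> n}. admissible_patterns n k)"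
    (is "_ = ?f ` ?I")
proof (intro equalityI subsetI)
  fix w assume "w \<in> solutions_of_length n"
  then obtain a b where w: "length w = n" "hd w = 0" and a: "1 \<le> a" and sol: "is_solution a b w"
    by (auto simp: solutions_of_length_def)
  define k where "k = count_list w 1"
  show "w \<in> ?f ` ?I"
  proof (cases "k = 0")
    case True
    then have "1 \<notin> set w" by (simp add: k_def count_list_0_iff)
    then have "w = replicate n 0"
      using w(1) bit_one_or_zero by (metis replicate_eqI)
    then have "w = ?f (0, {})" by (simp add: pattern_word_0)
    moreover have "(0, {}) \<in> ?I" using admissible_patterns_0[OF n] by simp
    ultimately show ?thesis by blast
  next
    case False
    then have k: "0 < count_list w 1" by (simp add: k_def)
    obtain A where A: "2 * k \<le> n" "A \<in> pattern_sets (gcd n k)"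
      "w = map (pattern_letter n k A) [0..<n]" "in_lang (pattern_letter n k A) (2 * n) a b"
      using solution_is_pattern[OF a sol w(2) k] unfolding w(1) k_def by metis
    then have "A \<in> admissible_patterns n k"
      using pattern_not_in_lang[of k n A a b] False by (auto simp: admissible_patterns_def)
    then have "(k, A) \<in> ?I" using A(1) by simp
    moreover have "w = ?f (k, A)" using A(3) by simp
    ultimately show ?thesis by blast
  qed
next
  fix w assume "w \<in> ?f ` ?I"
  then obtain k A where k: "2 * k \<le> n" and A: "A \<in> admissible_patterns n k"
    and w: "w = map (pattern_letter n k A) [0..<n]" by auto
  obtain a b where ab: "1 \<le> a" "is_solution a b w"
    using admissible_pattern_solution[OF n k A] w by blast
  have "hd w = pattern_letter n k A 0" using n by (simp add: w hd_map)
  also have "\<dots> = 0" using A by (simp add: pattern_letter_def admissible_patterns_def pattern_sets_def)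
  finally show "w \<in> solutions_of_length n"
    using ab is_solution_no_11[OF ab(2,1)] w by (auto simp: solutions_of_length_def)
qed

text \<open>The number of ones recovers \<open>k\<close>, and the letters at multiples of the block
  length recover \<open>A\<close>.\<close>

lemma inj_on_pattern_word:
  assumes n: "0 < n"
  shows "inj_on (\<lambda>(k, A). map (pattern_letter n k A) [0..<n])
    (SIGMA k:{k. 2 * k \<le> n}. admissible_patterns n k)"
proof (rule inj_onI, clarify)
  fix k A k' A'
  assume k: "2 * k \<le> n" "A \<in> admissible_patterns n k"
    and k': "2 * k' \<le> n" "A' \<in> admissible_patterns n k'"
    and eq: "map (pattern_letter n k A) [0..<n] = map (pattern_letter n k' A') [0..<n]"
  have kk: "k' = k" using pattern_word_count[OF n k] pattern_word_count[OF n k'] eq by simp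
  define g where "g = gcd n k"
  have d: "0 < n div g" "g * (n div g) = n" using gcd_period_pos[OF n] by (simp_all add: g_def)
  have "i \<in> A \<longleftrightarrow> i \<in> A'" if i: "i < g" for i
  proof -
    have "i * (n div g) < n" using i d by (metis mult_less_mono1)
    then have "pattern_letter n k A (i * (n div g)) = pattern_letter n k A' (i * (n div g))"
      using eq kk by simp
    then have "of_bool (i \<in> A) = (of_bool (i \<in> A') :: bit)"
      using pattern_letter_multiple[OF n] i by (simp add: g_def)
    then show ?thesis by (simp only: of_bool_eq_iff)
  qed
  moreover have "A \<subseteq> {0..<g}" "A' \<subseteq> {0..<g}"
    using k k' kk by (auto simp: admissible_patterns_def pattern_sets_def g_def)
  ultimately have "A = A'" by (auto simp: subset_iff)
  then show "k = k' \<and> A = A'" using kk by simp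
qed

subsection \<open>Counting\<close>

lemma equiv_doubling_orbit_rel: "equiv {0..<l} (doubling_orbit_rel l)"
proof (rule equivI)
  show "refl_on {0..<l} (doubling_orbit_rel l)"
    by (rule refl_onI) (auto simp: doubling_orbit_rel_def intro!: exI[of _ "0::nat"])
  show "sym (doubling_orbit_rel l)"
    by (rule symI) (auto simp: doubling_orbit_rel_def intro: cong_sym)
  show "trans (doubling_orbit_rel l)"
  proof (rule transI)
    fix x y z assume "(x, y) \<in> doubling_orbit_rel l" "(y, z) \<in> doubling_orbit_rel l"
    then obtain a b c e where *: "x < l" "z < l" "[2 ^ a * x = 2 ^ b * y] (mod l)"
      "[2 ^ c * y = 2 ^ e * z] (mod l)" by (auto simp: doubling_orbit_rel_def)
    have "[2 ^ c * (2 ^ a * x) = 2 ^ c * (2 ^ b * y)] (mod l)" using *(3) by (rule cong_scalar_left)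
    moreover have "[2 ^ b * (2 ^ c * y) = 2 ^ b * (2 ^ e * z)] (mod l)"
      using *(4) by (rule cong_scalar_left)
    ultimately have "[2 ^ (c + a) * x = 2 ^ (b + e) * z] (mod l)"
      by (simp add: power_add mult.assoc mult.left_commute) (metis cong_trans mult.left_commute)
    then show "(x, z) \<in> doubling_orbit_rel l" using * by (auto simp: doubling_orbit_rel_def)
  qed
qed (auto simp: doubling_orbit_rel_def)

lemma pattern_set_orbit:
  assumes A: "A \<in> pattern_sets g" and ij: "(i, j) \<in> doubling_orbit_rel g" and i: "i \<in> A"
  shows "j \<in> A"
proof -
  have iter: "2 ^ m * i mod g \<in> A \<longleftrightarrow> i \<in> A" if "i < g" for m i
  proof (induction m)
    case (Suc m)
    have "2 ^ Suc m * i mod g = 2 * (2 ^ m * i mod g) mod g"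
      by (simp add: mod_mult_right_eq mult.assoc)
    moreover have "2 ^ m * i mod g < g" using that by simp
    ultimately show ?case using A Suc by (auto simp: pattern_sets_def)
  qed (use that in simp)
  obtain a b where "i < g" "j < g" "2 ^ a * i mod g = 2 ^ b * j mod g"
    using ij by (auto simp: doubling_orbit_rel_def cong_def)
  then show ?thesis using iter[of i a] iter[of j b] i by simp
qed

text \<open>Orbits are disjoint and nonempty, so distinct sets of orbits have distinct unions; the
  patterns correspond to the subsets of the orbits other than that of 0.\<close>

lemma card_pattern_sets:
  assumes g: "0 < g"
  shows "finite (pattern_sets g)" "card (pattern_sets g) = 2 ^ (num_orbits g - 1)"
proof -
  define E where "E = doubling_orbit_rel g"
  define Q where "Q = {0..<g} // E"
  have eq: "equiv {0..<g} E" by (simp add: E_def equiv_doubling_orbit_rel)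
  have finQ: "finite Q" unfolding Q_def using eq by (intro finite_quotient) (auto simp: E_def doubling_orbit_rel_def)
  have Q0: "E `` {0} \<in> Q" using g by (auto simp: Q_def intro: quotientI)
  have img: "Union ` Pow (Q - {E `` {0}}) = pattern_sets g"
  proof (intro equalityI subsetI)
    fix A assume "A \<in> Union ` Pow (Q - {E `` {0}})"
    then obtain B where B: "B \<subseteq> Q - {E `` {0}}" "A = \<Union>B" by blast
    have sub: "A \<subseteq> {0..<g}" using B eq in_quotient_imp_subset by (fastforce simp: Q_def)
    have closed: "j \<in> A" if ij: "(i, j) \<in> E" and i: "i \<in> A" for i j
    proof -
      obtain c where c: "c \<in> B" "i \<in> c" using i B by blast
      then have "j \<in> c" using in_quotient_imp_closed[OF eq, of c i j] ij B by (auto simp: Q_def)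
      then show ?thesis using c B by blast
    qed
    have "0 \<notin> A"
    proof
      assume "0 \<in> A"
      then obtain c where c: "c \<in> B" "0 \<in> c" using B by blast
      moreover have "0 \<in> E `` {0}" using g by (intro equiv_class_self[OF eq]) simp
      moreover have "c \<in> Q" using c B by blast
      ultimately have "c = E `` {0}" using quotient_disj[OF eq, of c "E `` {0}"] Q0
        by (auto simp: Q_def)
      then show False using c B by blast
    qed
    moreover have "2 * i mod g \<in> A \<longleftrightarrow> i \<in> A" if "i < g" for i
    proof -
      have "[2 ^ 1 * i = 2 ^ 0 * (2 * i mod g)] (mod g)" by (simp add: cong_def)
      then have "(i, 2 * i mod g) \<in> E"
        using that g unfolding E_def doubling_orbit_rel_def by (blast intro: mod_less_divisor)
      moreover from this have "(2 * i mod g, i) \<in> E" using eq by (meson equivE symD)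
      ultimately show ?thesis using closed by blast
    qed
    ultimately show "A \<in> pattern_sets g" using sub by (simp add: pattern_sets_def)
  next
    fix A assume A: "A \<in> pattern_sets g"
    then have sub: "A \<subseteq> {0..<g}" and A0: "0 \<notin> A" by (auto simp: pattern_sets_def)
    define B where "B = (\<lambda>i. E `` {i}) ` A"
    have in_class: "j \<in> A" if "i \<in> A" "j \<in> E `` {i}" for i j
      using pattern_set_orbit[OF A _ that(1), of j] that(2) by (simp add: E_def)
    have self: "i \<in> E `` {i}" if "i < g" for i using that by (intro equiv_class_self[OF eq]) simp
    have "\<Union>B = A" using in_class self sub by (force simp: B_def)
    moreover have "B \<subseteq> Q - {E `` {0}}"
      using sub in_class self[OF g] A0 by (auto simp: B_def Q_def intro: quotientI)
    ultimately show "A \<in> Union ` Pow (Q - {E `` {0}})" by blast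
  qed
  have inj: "inj_on Union (Pow Q)"
  proof -
    have sub: "B \<subseteq> B'" if "B \<subseteq> Q" "B' \<subseteq> Q" "\<Union>B = \<Union>B'" for B B'
    proof
      fix c assume c: "c \<in> B"
      then have "c \<noteq> {}" using that(1) in_quotient_imp_non_empty[OF eq] unfolding Q_def by blast
      then obtain x where x: "x \<in> c" by blast
      then have "x \<in> \<Union>B'" unfolding that(3)[symmetric] using c by blast
      then obtain c' where "x \<in> c'" "c' \<in> B'" by blast
      moreover have "c \<in> {0..<g} // E" "c' \<in> {0..<g} // E"
        using c that(1,2) \<open>c' \<in> B'\<close> by (auto simp: Q_def)
      ultimately have "c = c'" using quotient_disj[OF eq, of c c'] x by blast
      then show "c \<in> B'" using \<open>c' \<in> B'\<close> by simp
    qed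
    show ?thesis
    proof (rule inj_onI)
      fix B B' assume "B \<in> Pow Q" "B' \<in> Pow Q" "\<Union>B = \<Union>B'"
      then show "B = B'" using sub[of B B'] sub[of B' B] by (metis PowD subset_antisym)
    qed
  qed
  have "inj_on Union (Pow (Q - {E `` {0}}))" using inj by (rule inj_on_subset) auto
  then have "card (pattern_sets g) = card (Pow (Q - {E `` {0}}))"
    unfolding img[symmetric] by (rule card_image)
  also have "\<dots> = 2 ^ (card Q - 1)" using finQ Q0 by (simp add: card_Pow)
  finally show "card (pattern_sets g) = 2 ^ (num_orbits g - 1)"
    by (simp add: num_orbits_def Q_def E_def)
  show "finite (pattern_sets g)" unfolding img[symmetric] using finQ by simp
qed

section \<open>Totatives and reduced fractions\<close>

lemma card_half_totatives:
  assumes d: "2 < (d :: nat)"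
  shows "2 * card {k. coprime k d \<and> 2 * k \<le> d} = totient d"
proof -
  let ?C = "{k. coprime k d \<and> 2 * k \<le> d}"
  have fin: "finite ?C" by (rule finite_subset[of _ "{..d}"]) auto
  have pos: "0 < k" if "k \<in> ?C" for k using that d by (cases k) auto
  \<comment> \<open>If \<open>2 * k = d\<close>, then \<open>k\<close> divides \<open>d\<close>, so
    coprimality gives \<open>k = 1\<close> and \<open>d = 2\<close>.\<close>
  have lt: "2 * k < d" if "k \<in> ?C" for k
  proof (rule ccontr)
    assume "\<not> 2 * k < d"
    then have "d = 2 * k" using that by simp
    then have "k dvd d" by simp
    then have "k = 1" using that by (metis (no_types, lifting) coprime_common_divisor_nat dvd_refl mem_Collect_eq)
    then show False using \<open>d = 2 * k\<close> d by simp
  qed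
  have cop: "coprime (d - k) d \<longleftrightarrow> coprime k d" if "k \<le> d" for k
    using that by (metis coprime_iff_gcd_eq_1 diff_diff_cancel gcd.commute gcd_diff1_nat gcd_diff2_nat diff_le_self)
  \<comment> \<open>The reflection \<open>d - k\<close> preserves coprimality and exchanges the
    totatives below and above \<open>d / 2\<close>.\<close>
  have "totatives d = ?C \<union> (\<lambda>k. d - k) ` ?C"
  proof (intro equalityI subsetI)
    fix k assume k: "k \<in> totatives d"
    then have k': "0 < k" "k \<le> d" "coprime k d" by (auto simp: totatives_def)
    show "k \<in> ?C \<union> (\<lambda>k. d - k) ` ?C"
    proof (cases "2 * k \<le> d")
      case False
      then have "d - k \<in> ?C" using k' cop by simp
      moreover have "k = d - (d - k)" using k' by simp
      ultimately show ?thesis by blast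
    qed (use k' in simp)
  next
    fix k assume "k \<in> ?C \<union> (\<lambda>k. d - k) ` ?C"
    then show "k \<in> totatives d"
    proof
      assume "k \<in> ?C"
      then show ?thesis using pos[of k] by (auto simp: totatives_def)
    next
      assume "k \<in> (\<lambda>k. d - k) ` ?C"
      then obtain j where j: "j \<in> ?C" "k = d - j" by blast
      then show ?thesis using lt[of j] cop[of j] by (auto simp: totatives_def)
    qed
  qed
  moreover have "?C \<inter> (\<lambda>k. d - k) ` ?C = {}" using lt by fastforce
  moreover have "inj_on (\<lambda>k. d - k) ?C" by (rule inj_onI) auto
  ultimately show ?thesis using fin
    by (simp add: totient_def card_Un_disjoint card_image)
qed

text \<open>Every divisor of \<open>d - 1\<close> is coprime to \<open>d\<close>, and all except
  \<open>d - 1\<close> itself are at most \<open>d / 2\<close>; so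
  \<open>num_divisors (d - 1) - 1\<close> elements are removed from half of the totatives.\<close>

lemma card_nondivisor_totatives:
  assumes d: "2 < (d :: nat)"
  shows "real (card {k. coprime k d \<and> 2 * k \<le> d \<and> \<not> k dvd d - 1}) =
    real (totient d) / 2 - real (num_divisors (d - 1)) + 1"
proof -
  let ?C = "{k. coprime k d \<and> 2 * k \<le> d}"
  let ?D = "{k. k dvd d - 1} - {d - 1}"
  have fin: "finite ?C" by (rule finite_subset[of _ "{..d}"]) auto
  have finD: "finite {k. k dvd d - 1}" using d by simp
  have sub: "?D \<subseteq> ?C"
  proof
    fix k assume "k \<in> ?D"
    then obtain m where m: "d - 1 = k * m" "k \<noteq> d - 1" by (auto elim: dvdE)
    have "m \<noteq> 0" using m(1) d by (intro notI) simp
    moreover have "m \<noteq> 1" using m by auto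
    ultimately have "k * 2 \<le> k * m" by (intro mult_le_mono2) linarith
    then have "2 * k \<le> d" using m(1) by linarith
    moreover have "coprime (d - 1) d" using d by (metis coprime_diff_one_left_nat less_trans pos2)
    then have "coprime k d" using m by (metis coprime_mult_left_iff)
    ultimately show "k \<in> ?C" by simp
  qed
  have "{k. coprime k d \<and> 2 * k \<le> d \<and> \<not> k dvd d - 1} = ?C - ?D"
    using d by auto
  then have "card {k. coprime k d \<and> 2 * k \<le> d \<and> \<not> k dvd d - 1} = card ?C - card ?D"
    using card_Diff_subset[OF finite_subset[OF sub fin] sub] by argo
  moreover have "card ?D \<le> card ?C" using sub fin by (rule card_mono[rotated])
  moreover have "real (card ?D) = real (num_divisors (d - 1)) - 1"
  proof -
    have "0 < card {k. k dvd d - 1}" using finD by (auto simp: card_gt_0_iff)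
    then show ?thesis using finD by (simp add: num_divisors_def)
  qed
  moreover have "real (card ?C) = real (totient d) / 2"
    using card_half_totatives[OF d] by simp
  ultimately show ?thesis by simp
qed

lemma card_admissible_patterns:
  assumes n: "0 < n"
  shows "finite (admissible_patterns n k)"
    "real (card (admissible_patterns n k)) = 1 +
      (if k div gcd n k dvd n div gcd n k - 1 then 0 else 2 ^ (num_orbits (gcd n k) - 1) - 1)"
proof -
  have g: "0 < gcd n k" using n by simp
  show "finite (admissible_patterns n k)"
    using card_pattern_sets(1)[OF g] by (rule finite_subset[rotated]) (auto simp: admissible_patterns_def)
  show "real (card (admissible_patterns n k)) = 1 +
      (if k div gcd n k dvd n div gcd n k - 1 then 0 else 2 ^ (num_orbits (gcd n k) - 1) - 1)"
  proof (cases "k div gcd n k dvd n div gcd n k - 1")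
    case True
    then have "admissible_patterns n k = {{}}" by (auto simp: admissible_patterns_def)
    then show ?thesis using True by simp
  next
    case False
    then have "admissible_patterns n k = pattern_sets (gcd n k)" by (auto simp: admissible_patterns_def)
    then show ?thesis using False card_pattern_sets(2)[OF g] by simp
  qed
qed

text \<open>Reduce \<open>k / n\<close> to lowest terms: the denominators are divisors of
  \<open>n\<close>, and \<open>k = 0\<close> becomes \<open>0 / 1\<close>.\<close>

lemma sum_over_reduced_fractions:
  fixes h :: "nat \<Rightarrow> nat \<Rightarrow> real"
  assumes n: "0 < n"
  shows "(\<Sum>k | 2 * k \<le> n. h (n div gcd n k) (k div gcd n k)) =
    (\<Sum>d | d dvd n. \<Sum>k | coprime k d \<and> 2 * k \<le> d. h d k)"
proof -
  have fin: "finite {k. coprime k d \<and> 2 * k \<le> d}" for d :: nat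
    by (rule finite_subset[of _ "{..d}"]) auto
  have "(\<Sum>k | 2 * k \<le> n. h (n div gcd n k) (k div gcd n k)) =
    (\<Sum>(d, k) \<in> (SIGMA d:{d. d dvd n}. {k. coprime k d \<and> 2 * k \<le> d}). h d k)"
  proof (rule sum.reindex_bij_witness[where i = "\<lambda>(d, k). k * (n div d)"
        and j = "\<lambda>k. (n div gcd n k, k div gcd n k)"])
    fix k assume "k \<in> {k. 2 * k \<le> n}"
    then have k: "2 * k \<le> n" by simp
    define g where "g = gcd n k"
    have g: "0 < g" "g dvd n" "g dvd k" using n by (simp_all add: g_def)
    obtain d' k' where d: "n = g * d'" "k = g * k'" using g by (auto elim!: dvdE)
    have "n div (n div g) = g" using g n d by simp
    then show "(case (n div gcd n k, k div gcd n k) of (d, k) \<Rightarrow> k * (n div d)) = k"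
      using g by (simp add: g_def)
    have "coprime (k div g) (n div g)" unfolding g_def
      using div_gcd_coprime[of k n] n by (simp add: gcd.commute)
    moreover have "2 * (k div g) \<le> n div g" using k g(1) unfolding d by simp
    moreover have "n div g dvd n" using g by (simp add: div_dvd_iff_mult)
    ultimately show "(n div gcd n k, k div gcd n k) \<in> (SIGMA d:{d. d dvd n}. {k. coprime k d \<and> 2 * k \<le> d})"
      by (simp add: g_def)
  next
    fix p assume "p \<in> (SIGMA d:{d. d dvd n}. {k. coprime k d \<and> 2 * k \<le> d})"
    then obtain d k where p: "p = (d, k)" and dk: "d dvd n" "coprime k d" "2 * k \<le> d" by auto
    obtain g where g: "n = d * g" using dk by (auto elim: dvdE)
    have pos: "0 < d" "0 < g" using n g by auto
    have gcd: "gcd n (k * g) = g"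
      using dk(2) unfolding g by (metis coprime_commute coprime_iff_gcd_eq_1 gcd_mult_distrib_nat mult.commute mult.right_neutral)
    have "2 * (k * g) \<le> n" using dk(3) unfolding g by (metis mult.assoc mult_le_mono1)
    then show "(case p of (d, k) \<Rightarrow> k * (n div d)) \<in> {k. 2 * k \<le> n}" using pos by (simp add: p g)
    have nd: "n div d = g" using g pos by simp
    show "(n div gcd n (case p of (d, k) \<Rightarrow> k * (n div d)),
          (case p of (d, k) \<Rightarrow> k * (n div d)) div gcd n (case p of (d, k) \<Rightarrow> k * (n div d))) = p"
      unfolding p prod.case nd gcd using pos g by simp
  qed simp
  also have "\<dots> = (\<Sum>d | d dvd n. \<Sum>k | coprime k d \<and> 2 * k \<le> d. h d k)"
    using n fin by (subst sum.Sigma) auto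
  finally show ?thesis .
qed

theorem theorem4p3:
  fixes n :: nat
  assumes "n \<ge> 1"
  shows "real (card (solutions_of_length n)) =
           real_of_int \<lfloor>real n / 2\<rfloor> + 1 + (\<Sum>d\<in>{d. d dvd n \<and> 2 < d \<and> d \<le> n}. H_count n d)"
proof -
  have n: "0 < n" using assms by simp
  define K where "K = {k. 2 * k \<le> n}"
  have K: "K = {..n div 2}" by (auto simp: K_def)
  define c :: "nat \<Rightarrow> real" where "c d = 2 ^ (num_orbits (n div d) - 1) - 1" for d
  \<comment> \<open>\<open>h\<close> counts the nonempty admissible patterns that belong to the
    reduced fraction \<open>k / d\<close>.\<close>
  define h where "h d k = (if k dvd d - 1 then 0 else c d)" for d k
  have "card (solutions_of_length n) = (\<Sum>k\<in>K. card (admissible_patterns n k))"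
    using card_image[OF inj_on_pattern_word[OF n]] card_admissible_patterns(1)[OF n] K
    unfolding solutions_eq_image[OF n] K_def[symmetric] by simp
  then have "real (card (solutions_of_length n)) = (\<Sum>k\<in>K. real (card (admissible_patterns n k)))"
    by simp
  also have "\<dots> = (\<Sum>k\<in>K. 1 + h (n div gcd n k) (k div gcd n k))"
  proof (rule sum.cong)
    fix k
    have "n div (n div gcd n k) = gcd n k"
      using n by (metis dvd_div_eq_mult dvd_mult_div_cancel gcd_dvd1 gcd_period_pos less_numeral_extra(3) nonzero_mult_div_cancel_left mult.commute)
    then show "real (card (admissible_patterns n k)) = 1 + h (n div gcd n k) (k div gcd n k)"
      by (simp add: card_admissible_patterns(2)[OF n] h_def c_def)
  qed simp
  \<comment> \<open>The empty pattern contributes 1 for each of the \<open>n div 2 + 1\<close>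
    values of \<open>k\<close>.\<close>
  also have "\<dots> = real (n div 2) + 1 + (\<Sum>k\<in>K. h (n div gcd n k) (k div gcd n k))"
    by (simp add: sum.distrib K)
  also have "(\<Sum>k\<in>K. h (n div gcd n k) (k div gcd n k)) =
      (\<Sum>d | d dvd n. \<Sum>k | coprime k d \<and> 2 * k \<le> d. h d k)"
    unfolding K_def by (rule sum_over_reduced_fractions[OF n])
  also have "\<dots> = (\<Sum>d | d dvd n. c d * real (card {k. coprime k d \<and> 2 * k \<le> d \<and> \<not> k dvd d - 1}))"
  proof (rule sum.cong)
    fix d :: nat
    have fin: "finite {k. coprime k d \<and> 2 * k \<le> d}" by (rule finite_subset[of _ "{..d}"]) auto
    have "(\<Sum>k | coprime k d \<and> 2 * k \<le> d. h d k) =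
        (\<Sum>k | coprime k d \<and> 2 * k \<le> d \<and> \<not> k dvd d - 1. c d)"
      using fin by (intro sum.mono_neutral_cong_right) (auto simp: h_def)
    then show "(\<Sum>k | coprime k d \<and> 2 * k \<le> d. h d k) =
        c d * real (card {k. coprime k d \<and> 2 * k \<le> d \<and> \<not> k dvd d - 1})" by simp
  qed simp
  \<comment> \<open>For \<open>d = 1\<close> only \<open>k = 0\<close> and for \<open>d = 2\<close>
    only \<open>k = 1\<close> qualify, and both divide \<open>d - 1\<close>.\<close>
  also have "\<dots> = (\<Sum>d | d dvd n \<and> 2 < d \<and> d \<le> n.
      c d * real (card {k. coprime k d \<and> 2 * k \<le> d \<and> \<not> k dvd d - 1}))"
  proof (rule sum.mono_neutral_right)
    show "\<forall>d\<in>{d. d dvd n} - {d. d dvd n \<and> 2 < d \<and> d \<le> n}.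
        c d * real (card {k. coprime k d \<and> 2 * k \<le> d \<and> \<not> k dvd d - 1}) = 0"
    proof
      fix d assume "d \<in> {d. d dvd n} - {d. d dvd n \<and> 2 < d \<and> d \<le> n}"
      then have "d \<le> 2" "d \<noteq> 0" using n dvd_imp_le by auto
      then have "{k. coprime k d \<and> 2 * k \<le> d \<and> \<not> k dvd d - 1} = {}"
      proof -
        have "k dvd d - 1" if "coprime k d" "2 * k \<le> d" for k
        proof (cases "d = 1")
          case False
          then have "d = 2" using \<open>d \<le> 2\<close> \<open>d \<noteq> 0\<close> by linarith
          moreover from this have "k = 1" using that by (cases k) auto
          ultimately show ?thesis by simp
        qed simp
        then show ?thesis by blast
      qed
      then show "c d * real (card {k. coprime k d \<and> 2 * k \<le> d \<and> \<not> k dvd d - 1}) = 0"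
        by (simp only: card.empty of_nat_0 mult_zero_right)
    qed
  qed (use n in auto)
  also have "\<dots> = (\<Sum>d\<in>{d. d dvd n \<and> 2 < d \<and> d \<le> n}. H_count n d)"
    by (intro sum.cong refl)
      (simp only: H_count_def c_def card_nondivisor_totatives mem_Collect_eq)
  also have "real (n div 2) = real_of_int \<lfloor>real n / 2\<rfloor>"
    by (simp add: floor_divide_of_nat_eq[of n 2, simplified])
  finally show ?thesis .
qed

end
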